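(* Fix $n,d$ and the training data (hence $\hat w$). Suppose the link function satisfies $\sigma(x)=\Phi(a x+b)$ for all $x\in\mathbb{R}$, for some $a\in\mathbb{R}\setminus\{0\}$ and $b\in\mathbb{R}$, where $\Phi$ is the standard normal distribution function. Define $$A_*=\frac{\cos(\theta_* )}{\|\hat w\|_\Sigma\sqrt{1+a^2\sin^2(\theta_* )}},\qquad B_*=\frac{b}{a}\left(\frac{1}{\sqrt{1+a^2\sin^2(\theta_* )}}-1\right),$$ and suppose $(A_*,B_* )$ is contained in a compact subset $\mathcal{H}\subset\mathbb{R}^2$. Consider the Platt-scaled predictor $$\hat f^{\,n_{\mathrm{ho}}}_{\mathrm{platt}}(u)=\sigma\big(\hat A^{n_{\mathrm{ho}}}u+\hat B^{n_{\mathrm{ho}}}\big),\qquad (\hat A^{n_{\mathrm{ho}}},\hat B^{n_{\mathrm{ho}}})\in\arg\min_{(A,B)\in\mathcal{H}}\hat\ell_{n_{\mathrm{ho}}}\big(u\mapsto\sigma(Au+B)\big).$$ Then the angular predictor satisfies $$\hat f_{\mathrm{ang}}(u;\theta_* )=\sigma(A_*u+B_* )\quad\text{for all }u\in\mathbb{R},$$ so that it belongs to $\mathcal{F}_{\mathrm{platt}}=\{u\mapsto\sigma(Au+B):A,B\in\mathbb{R}\}$. Moreover, as $n_{\mathrm{ho}}\to\infty$, $\hat A^{n_{\mathrm{ho}}}\to A_*$ and $\hat B^{n_{\mathrm{ho}}}\to B_*$ in probability, and $$\sup_{u\in\mathbb{R}}\left|\hat f^{\,n_{\mathrm{ho}}}_{\mathrm{platt}}(u)-\hat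 f_{\mathrm{ang}}(u;\theta_* )\right|\to0$$ in probability, where convergence in probability is with respect to the randomness of the holdout set $\{(x_{\mathrm{ho},i},y_{\mathrm{ho},i})\}_{i=1}^{n_{\mathrm{ho}}}$.
   Context: Data model: i.i.d. pairs $(x,y)$ with $x\sim N(0,\Sigma)$ in $\mathbb{R}^d$ ($\Sigma$ known) and, conditionally on $x$, $y\sim\mathrm{Bern}(\sigma(w_\star^\top x))$; $w_\star\in\mathbb{R}^d$ is deterministic with $\|w_\star\|_\Sigma=1$, where $\langle u,v\rangle_\Sigma=u^\top\Sigma v$ and $\|u\|_\Sigma=\sqrt{u^\top\Sigma u}$. From $n$ training pairs $(x_i,y_i)$ one computes $\hat w=\arg\min_w\frac1n\sum_{i=1}^n\ell_{y_i}(w^\top x_i)+g(w)$, with $\ell$ a convex loss and $g$ a convex penalty (with $\hat w\ne0$ so that the angle below is defined). Angle: $\theta_*=\arccos\left(\frac{\langle w_\star,\hat w\rangle_\Sigma}{\|\hat w\|_\Sigma\|w_\star\|_\Sigma}\right)$. Angular predictor: $\hat f_{\mathrm{ang}}(u;\theta)=\mathbb{E}_Z\left[\sigma\left(\cos(\theta)\cdot\frac{u}{\|\hat w\|_\Sigma}+\sin(\theta)\cdot Z\right)\right]$ with $Z\sim N(0,1)$. Holdout set: $(x_{\mathrm{ho},i},y_{\mathrm{ho},i})_{i=1}^{n_{\mathrm{ho}}}$ are i.i.d. from the same data model, independent of the training data. For $F:\mathbb{R}\to[0,1]$ the holdout negative log-likelihood is $$\hat\ell_{n_{\mathrm{ho}}}(F)=\sum_{i=1}^{n_{\mathrm{ho}}}-y_{\mathrm{ho},i}\log\big(F(\hat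 w^\top x_{\mathrm{ho},i})\big)-(1-y_{\mathrm{ho},i})\log\big(1-F(\hat w^\top x_{\mathrm{ho},i})\big).$$
   Formalization: The uniform convergence over all real u is proved only when cos(θ_* ) ≠ 0 (i.e. A_* ≠ 0); if A_* = 0 and H is, say, a box around (A_*,B_* ), the estimated slope is nonzero with probability tending to 1 and the supremum is then at least 1/2. *)

theory Defs
  imports "HOL-Probability.Probability"
begin

definition cov_matrix :: "real^'d^'d \<Rightarrow> bool" where
  "cov_matrix S \<longleftrightarrow> transpose S = S \<and> (\<forall>v. 0 \<le> v \<bullet> (S *v v))"

definition cov_inner :: "real^'d^'d \<Rightarrow> real^'d \<Rightarrow> real^'d \<Rightarrow> real" where
  "cov_inner S u v = u \<bullet> (S *v v)"

definition cov_norm :: "real^'d^'d \<Rightarrow> real^'d \<Rightarrow> real" where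
  "cov_norm S u = sqrt (cov_inner S u u)"

definition cov_angle :: "real^'d^'d \<Rightarrow> real^'d \<Rightarrow> real^'d \<Rightarrow> real" where
  "cov_angle S u v = arccos (cov_inner S u v / (cov_norm S v * cov_norm S u))"

(* The library's normal_density is 0 almost everywhere for standard deviation 0, hence the
   separate point-mass case, which is needed for singular covariance matrices. *)
definition normal_law :: "real \<Rightarrow> real \<Rightarrow> real measure" where
  "normal_law m s = (if s = 0 then return borel m else density lborel (normal_density m s))"

(* X is distributed as N(0,S): every linear functional of X is univariate normal with mean 0
   and the variance prescribed by S. *)
definition centered_gaussian ::
    "'w measure \<Rightarrow> ('w \<Rightarrow> real^'d) \<Rightarrow> real^'d^'d \<Rightarrow> bool" where
  "centered_gaussian M X S \<longleftrightarrow>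
     X \<in> borel_measurable M \<and>
     (\<forall>v. distr M borel (\<lambda>\<omega>. v \<bullet> X \<omega>) = normal_law 0 (cov_norm S v))"

(* The label True stands for y = 1.  The last conjunct is P(y = 1 | x) = sigma(w . x) almost
   surely, conditioning on the sigma-algebra generated by x. *)
definition data_model ::
    "'w measure \<Rightarrow> real^'d^'d \<Rightarrow> (real \<Rightarrow> real) \<Rightarrow> real^'d \<Rightarrow>
     ('w \<Rightarrow> real^'d) \<Rightarrow> ('w \<Rightarrow> bool) \<Rightarrow> bool" where
  "data_model M S \<sigma> w x y \<longleftrightarrow>
     centered_gaussian M x S \<and>
     y \<in> measurable M (count_space UNIV) \<and>
     (AE \<omega> in M. real_cond_exp M (vimage_algebra (space M) x borel) (\<lambda>\<omega>. of_bool (y \<omega>)) \<omega>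
        = \<sigma> (w \<bullet> x \<omega>))"

definition angular_predictor ::
    "real^'d^'d \<Rightarrow> (real \<Rightarrow> real) \<Rightarrow> real^'d \<Rightarrow> real \<Rightarrow> real \<Rightarrow> real" where
  "angular_predictor S \<sigma> w_hat u \<theta> =
     (\<integral>z. \<sigma> (cos \<theta> * (u / cov_norm S w_hat) + sin \<theta> * z) \<partial>std_normal_distribution)"

definition platt_class :: "(real \<Rightarrow> real) \<Rightarrow> (real \<Rightarrow> real) set" where
  "platt_class \<sigma> = {f. \<exists>A B. f = (\<lambda>u. \<sigma> (A * u + B))}"

definition empirical_risk ::
    "nat \<Rightarrow> (nat \<Rightarrow> real^'d) \<Rightarrow> (nat \<Rightarrow> bool) \<Rightarrow> (bool \<Rightarrow> real \<Rightarrow> real) \<Rightarrow>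
     (real^'d \<Rightarrow> real) \<Rightarrow> real^'d \<Rightarrow> real" where
  "empirical_risk n x y loss g w = 1 / real n * (\<Sum>i<n. loss (y i) (w \<bullet> x i)) + g w"

(* Since ln 0 = 0 in HOL, this is the negative log-likelihood only for predictors F with
   values strictly between 0 and 1; this holds for F u = Phi (a * (A * u + B) + b). *)
definition holdout_nll ::
    "real^'d \<Rightarrow> nat \<Rightarrow> (nat \<Rightarrow> real^'d) \<Rightarrow> (nat \<Rightarrow> bool) \<Rightarrow> (real \<Rightarrow> real) \<Rightarrow> real" where
  "holdout_nll w_hat n x y F =
     (\<Sum>i<n. - of_bool (y i) * ln (F (w_hat \<bullet> x i))
             - (1 - of_bool (y i)) * ln (1 - F (w_hat \<bullet> x i)))"

(* Measurability is part of the definition: measure M assigns 0 to nonmeasurable sets. *)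
definition tendsto_in_prob :: "'w measure \<Rightarrow> (nat \<Rightarrow> 'w \<Rightarrow> real) \<Rightarrow> real \<Rightarrow> bool" where
  "tendsto_in_prob M X c \<longleftrightarrow>
     (\<forall>n. X n \<in> borel_measurable M) \<and>
     (\<forall>\<epsilon>>0. (\<lambda>n. measure M {\<omega> \<in> space M. \<bar>X n \<omega> - c\<bar> > \<epsilon>}) \<longlonglongrightarrow> 0)"

end

theory Submission
  imports Defs
begin

text \<open>For the probit link, \<open>E \<Phi>(\<alpha> + \<beta> Z) = \<Phi>(\<alpha> / sqrt (1 + \<beta>\<^sup>2))\<close>, so that the angular predictor is
  itself of Platt form with parameters \<open>(A_star, B_star)\<close>. The part of \<open>w_star \<bullet> x\<close> that is uncorrelated with
  \<open>w_hat \<bullet> x\<close> is independent of it; integrating it out shows that the angular predictor is the conditional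
  probability of \<open>y = 1\<close> given \<open>w_hat \<bullet> x\<close>. Platt scaling is therefore maximum likelihood estimation in
  a well-specified model: by Gibbs' inequality \<open>(A_star, B_star)\<close> is the only minimizer of the population
  risk, and Wald's argument gives consistency on the compact set \<open>H\<close>. The loss \<open>- ln \<Phi>\<close> has a
  derivative of at most linear growth (Mills ratio), so it has an integrable Lipschitz constant
  in the parameters and the weak law of large numbers suffices.\<close>

section \<open>The standard normal distribution function\<close>

text \<open>Two obstacles shape the proof. The Gaussian hypothesis speaks only of one-dimensional
  projections, and \<open>S\<close> may be singular, so no joint density is at hand; independence of
  two projections has to be read off the characteristic function of their linear combinations. And
  the last claim is uniform in \<open>u\<close> over the whole line, where convergence of the
  parameters is not enough: if \<open>cos \<theta>\<close> vanishes, then \<open>A_star\<close> is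
  0, the angular predictor is constant, and every nonzero slope \<open>A_hat\<close> keeps the
  supremum at 1/2 or more, since the Platt predictor runs through all of (0, 1). Hence the condition
  on \<open>cos \<theta>\<close> in the uniform statement. For nonzero \<open>A_star\<close>, a
  small relative error of the slope is a small rescaling, which \<open>Phi\<close> tolerates
  uniformly. The factor \<open>sqrt (1 + a\<^sup>2 * (sin \<theta>)\<^sup>2)\<close> is the standard
  deviation of the link's own standard normal noise plus \<open>a\<close> times the part of
  \<open>w_star \<bullet> x\<close> that \<open>w_hat \<bullet> x\<close> leaves
  undetermined.\<close>

abbreviation (input) Phi :: "real \<Rightarrow> real" where
  "Phi \<equiv> cdf std_normal_distribution"

interpretation std_normal: real_distribution std_normal_distribution
  by (rule real_dist_normal_dist)

lemma continuous_std_normal_density: "continuous_on A std_normal_density"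
  unfolding std_normal_density_def[abs_def] by (intro continuous_intros) auto

lemma integral_std_normal:
  fixes f :: "real \<Rightarrow> real"
  assumes "f \<in> borel_measurable borel"
  shows "(\<integral>x. f x \<partial>std_normal_distribution) = (\<integral>x. f x * std_normal_density x \<partial>lborel)"
proof -
  have "(\<integral>x. f x \<partial>std_normal_distribution) = (\<integral>x. std_normal_density x * f x \<partial>lborel)"
    using assms by (intro integral_real_density) (measurable, simp)
  thus ?thesis by (simp only: mult.commute)
qed

lemma Phi_diff:
  assumes "a \<le> b"
  shows "Phi b - Phi a = integral {a..b} std_normal_density"
proof (cases "a = b")
  case False
  with assms have "a < b" by simp
  have int: "set_integrable lborel {a..b} std_normal_density"
    by (intro borel_integrable_atLeastAtMost' continuous_std_normal_density)
  have "Phi b - Phi a = measure std_normal_distribution {a<..b}"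
    using \<open>a < b\<close> by (rule std_normal.cdf_diff_eq)
  also have "\<dots> = (\<integral>x. indicator {a<..b} x \<partial>std_normal_distribution)"
    by simp
  also have "\<dots> = (\<integral>x. indicator {a<..b} x * std_normal_density x \<partial>lborel)"
    by (rule integral_std_normal) simp
  also have "\<dots> = (\<integral>x. indicator {a..b} x * std_normal_density x \<partial>lborel)"
  proof (rule integral_cong_AE)
    show "AE x in lborel. indicator {a<..b} x * std_normal_density x
        = indicator {a..b} x * std_normal_density x"
      using AE_lborel_singleton[of a] by eventually_elim (auto simp: indicator_def)
  qed auto
  also have "\<dots> = integral {a..b} std_normal_density"
    using set_borel_integral_eq_integral(2)[OF int] by (simp add: set_lebesgue_integral_def)
  finally show ?thesis .
qed simp

lemma DERIV_Phi: "(Phi has_real_derivative std_normal_density x) (at x)"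
proof -
  \<comment> \<open>The base point \<open>x - 1\<close> serves to make \<open>x\<close> an interior
    point, so that the derivative within the interval is a two-sided one.\<close>
  have "((\<lambda>t. integral {x - 1..t} std_normal_density) has_real_derivative std_normal_density x)
          (at x within {x - 1..x + 1})"
    by (intro integral_has_real_derivative continuous_std_normal_density) auto
  hence "((\<lambda>t. integral {x - 1..t} std_normal_density) has_real_derivative std_normal_density x)
          (at x)"
    by (subst (asm) at_within_Icc_at) auto
  hence D: "((\<lambda>t. Phi (x - 1) + integral {x - 1..t} std_normal_density)
          has_real_derivative std_normal_density x) (at x)"
    by (auto intro!: derivative_eq_intros)
  have "Phi (x - 1) + integral {x - 1..t} std_normal_density = Phi t" if "t \<in> {x - 1<..}" for t
    using Phi_diff[of "x - 1" t] that by auto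
  thus ?thesis
    by (intro has_field_derivative_transform_within_open[OF D, of "{x - 1<..}"]) auto
qed

lemmas DERIV_Phi_chain [derivative_intros] = DERIV_chain2[OF DERIV_Phi]

lemma continuous_on_Phi [continuous_intros]:
  "continuous_on A f \<Longrightarrow> continuous_on A (\<lambda>x. Phi (f x))"
  by (rule continuous_on_compose2[of UNIV Phi])
     (intro continuous_at_imp_continuous_on ballI DERIV_isCont[OF DERIV_Phi], assumption, simp)

lemma Phi_measurable [measurable]: "Phi \<in> borel_measurable borel"
  by (intro borel_measurable_continuous_onI continuous_intros)

lemma Phi_less: "Phi x < Phi y" if "x < y"
proof (rule DERIV_pos_imp_increasing[OF that])
  show "\<exists>d. DERIV Phi z :> d \<and> 0 < d" for z
    by (intro exI[of _ "std_normal_density z"] conjI DERIV_Phi normal_density_pos) simp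
qed

lemma Phi_inj: "Phi x = Phi y \<longleftrightarrow> x = y"
  using Phi_less[of x y] Phi_less[of y x] by (cases x y rule: linorder_cases) auto

lemma Phi_pos [simp]: "0 < Phi x"
  using Phi_less[of "x - 1" x] std_normal.cdf_nonneg[of "x - 1"] by linarith

lemma Phi_less_1 [simp]: "Phi x < 1"
  using Phi_less[of x "x + 1"] std_normal.cdf_bounded_prob[of "x + 1"] by linarith

text \<open>The derivative of \<open>Phi x + Phi (- x)\<close> vanishes because the density is even,
  so the sum equals its limit at infinity, which is 1.\<close>

lemma Phi_minus: "Phi (- x) = 1 - Phi x"
proof -
  have sym: "std_normal_density (- x) = std_normal_density x" for x
    by (simp add: std_normal_density_def)
  have "((\<lambda>x. Phi x + Phi (- x)) has_real_derivative 0) (at x)" for x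
    using sym by (auto intro!: derivative_eq_intros)
  hence const: "Phi y + Phi (- y) = Phi x + Phi (- x)" for y
    using DERIV_isconst_all by blast
  have "((\<lambda>y. Phi y + Phi (- y)) \<longlongrightarrow> 1 + 0) at_top"
    by (intro tendsto_add std_normal.cdf_lim_at_top_prob
          filterlim_compose[OF std_normal.cdf_lim_at_bot filterlim_uminus_at_bot_at_top])
  hence "((\<lambda>y::real. Phi x + Phi (- x)) \<longlongrightarrow> 1) at_top" by (subst (asm) const) simp
  hence "Phi x + Phi (- x) = 1" by (subst (asm) tendsto_const_iff) auto
  thus ?thesis by linarith
qed

section \<open>Bounds on the density and on the logarithmic loss\<close>

lemma std_normal_density_mono: "\<bar>x\<bar> \<le> \<bar>y\<bar> \<Longrightarrow> std_normal_density y \<le> std_normal_density x"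
  using abs_le_square_iff[of x y] by (simp add: std_normal_density_def divide_right_mono)

lemma std_normal_density_le_1: "std_normal_density x \<le> 1"
proof -
  have "1 / sqrt (2 * pi) \<le> 1" using pi_gt3 by (simp add: real_le_rsqrt)
  moreover have "exp (- x\<^sup>2 / 2) \<le> 1" by simp
  ultimately show ?thesis unfolding std_normal_density_def by (intro mult_le_one) auto
qed

text \<open>\<open>Phi (r * v)\<close> has derivative \<open>v * std_normal_density (r * v)\<close>
  in \<open>r\<close>; this bound controls it uniformly in \<open>v\<close>. It rests on
  \<open>exp y \<ge> 1 + y\<close> at \<open>y = x\<^sup>2 / 2\<close>.\<close>

lemma abs_mult_std_normal_density_le_1: "\<bar>x\<bar> * std_normal_density x \<le> 1"
proof -
  have "1 / sqrt (2 * pi) \<le> 1" using pi_gt3 by (simp add: real_le_rsqrt)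
  moreover have "\<bar>x\<bar> * exp (- x\<^sup>2 / 2) \<le> 1"
  proof -
    have "\<bar>x\<bar> \<le> 1 + x\<^sup>2 / 2"
      using zero_le_power2[of "\<bar>x\<bar> - 1"] by (simp add: power2_eq_square algebra_simps)
    also have "\<dots> \<le> exp (x\<^sup>2 / 2)" by (rule exp_ge_add_one_self)
    finally show ?thesis by (simp add: exp_minus field_simps)
  qed
  ultimately have "1 / sqrt (2 * pi) * (\<bar>x\<bar> * exp (- x\<^sup>2 / 2)) \<le> 1"
    using mult_le_one[of "1 / sqrt (2 * pi)" "\<bar>x\<bar> * exp (- x\<^sup>2 / 2)"] by fastforce
  thus ?thesis by (simp add: std_normal_density_def)
qed

text \<open>A mean value estimate on an interval of length \<open>1 / (1 + \<bar>t\<bar>)\<close> to the left of \<open>- \<bar>t\<bar>\<close>: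
  the density loses only a constant factor there.\<close>

lemma inverse_Mills_ratio_le: "std_normal_density t / Phi t \<le> exp 2 * (1 + \<bar>t\<bar>)"
proof -
  define x \<delta> where "x = \<bar>t\<bar>" and "\<delta> = 1 / (1 + \<bar>t\<bar>)"
  have \<delta>: "0 < \<delta>" "\<delta> \<le> 1" "x * \<delta> \<le> 1" and x: "0 \<le> x" by (auto simp: \<delta>_def x_def)
  obtain z where z: "- x - \<delta> < z" "z < - x"
      "Phi (- x) - Phi (- x - \<delta>) = \<delta> * std_normal_density z"
    using MVT2[of "- x - \<delta>" "- x" Phi std_normal_density] DERIV_Phi \<delta> by auto
  \<comment> \<open>Passing from \<open>x\<close> to \<open>x + \<delta>\<close> adds
    \<open>x * \<delta> + \<delta>\<^sup>2 / 2\<close>, at most 3/2, to half the square; rounded up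
    to 2, this is the origin of \<open>exp 2\<close>. The factor \<open>1 + \<bar>t\<bar>\<close> of
    the conclusion is \<open>1 / \<delta>\<close>.\<close>
  have "\<delta>\<^sup>2 \<le> 1" using \<delta> by (simp add: power_le_one)
  hence "t\<^sup>2 / 2 \<ge> (x + \<delta>)\<^sup>2 / 2 - 2"
    using \<delta> by (simp add: x_def power2_eq_square algebra_simps abs_if split: if_splits)
  hence "exp (- t\<^sup>2 / 2) \<le> exp (2 + - (x + \<delta>)\<^sup>2 / 2)" by simp
  hence "std_normal_density t \<le> exp 2 * std_normal_density (x + \<delta>)"
    using mult_left_mono[of "exp (- t\<^sup>2 / 2)" "exp (2 + - (x + \<delta>)\<^sup>2 / 2)" "1 / sqrt (2 * pi)"]
    unfolding std_normal_density_def exp_add by (simp only: mult_ac) simp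
  also have "std_normal_density (x + \<delta>) \<le> std_normal_density z"
    using z x by (intro std_normal_density_mono) auto
  also have "\<delta> * std_normal_density z \<le> Phi t"
  proof -
    have "Phi (- x) \<le> Phi t" by (intro std_normal.cdf_nondecreasing) (simp add: x_def)
    thus ?thesis using z(3) Phi_pos[of "- x - \<delta>"] by linarith
  qed
  hence "std_normal_density z \<le> Phi t * (1 + \<bar>t\<bar>)"
    by (simp add: \<delta>_def divide_simps split: if_splits)
  finally show ?thesis by (simp add: divide_simps mult_ac)
qed

definition neg_log_Phi :: "real \<Rightarrow> real" where
  "neg_log_Phi t = - ln (Phi t)"

lemma neg_log_Phi_nonneg: "0 \<le> neg_log_Phi t"
  using Phi_less_1[of t] by (simp add: neg_log_Phi_def less_imp_le)

lemma neg_log_Phi_measurable [measurable]: "neg_log_Phi \<in> borel_measurable borel"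
  unfolding neg_log_Phi_def[abs_def] by measurable

text \<open>Mean value bound: the derivative is minus the inverse Mills ratio. As
  \<open>neg_log_Phi\<close> grows quadratically at minus infinity, no global Lipschitz constant
  exists, and the bound has to depend on \<open>s\<close> and \<open>t\<close>.\<close>

lemma neg_log_Phi_diff_le:
  "\<bar>neg_log_Phi s - neg_log_Phi t\<bar> \<le> exp 2 * (1 + \<bar>s\<bar> + \<bar>t\<bar>) * \<bar>s - t\<bar>"
proof -
  have "norm (neg_log_Phi s - neg_log_Phi t) \<le> exp 2 * (1 + \<bar>s\<bar> + \<bar>t\<bar>) * norm (s - t)"
  proof (rule field_differentiable_bound[of "closed_segment s t"])
    fix z assume "z \<in> closed_segment s t"
    hence "\<bar>z\<bar> \<le> \<bar>s\<bar> + \<bar>t\<bar>" by (auto simp: closed_segment_eq_real_ivl split: if_splits)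
    hence "exp 2 * (1 + \<bar>z\<bar>) \<le> exp 2 * (1 + \<bar>s\<bar> + \<bar>t\<bar>)" by simp
    moreover have "norm (- (std_normal_density z / Phi z)) = std_normal_density z / Phi z"
      using Phi_pos[of z] by (simp add: less_imp_le)
    ultimately show "norm (- (std_normal_density z / Phi z)) \<le> exp 2 * (1 + \<bar>s\<bar> + \<bar>t\<bar>)"
      using inverse_Mills_ratio_le[of z] by linarith
    show "(neg_log_Phi has_field_derivative - (std_normal_density z / Phi z))
        (at z within closed_segment s t)"
      unfolding neg_log_Phi_def[abs_def]
      by (auto intro!: derivative_eq_intros has_field_derivative_at_within[OF DERIV_Phi])
  qed auto
  thus ?thesis by simp
qed

text \<open>The shift costs at most \<open>\<bar>c\<bar>\<close> because the density is at most 1.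
  The rescaling costs at most \<open>2 * \<bar>r - 1\<bar>\<close> whatever \<open>v\<close> is; for
  this the segment from \<open>r\<close> to 1 must stay away from 0, where the derivative in
  \<open>r\<close> is not bounded uniformly in \<open>v\<close>.\<close>

lemma Phi_affine_perturbation:
  assumes "1 / 2 \<le> r"
  shows "\<bar>Phi (r * v + c) - Phi v\<bar> \<le> \<bar>c\<bar> + 2 * \<bar>r - 1\<bar>"
proof -
  have "norm (Phi (r * v + c) - Phi (r * v)) \<le> 1 * norm (r * v + c - r * v)"
    by (rule field_differentiable_bound[of UNIV _ std_normal_density])
       (auto simp: DERIV_Phi std_normal_density_le_1)
  moreover have "norm (Phi (r * v) - Phi (1 * v)) \<le> 2 * norm (r - 1)"
  proof (rule field_differentiable_bound[of "{1 / 2..}" "\<lambda>r. Phi (r * v)"])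
    fix s :: real assume s: "s \<in> {1 / 2..}"
    show "((\<lambda>r. Phi (r * v)) has_field_derivative std_normal_density (s * v) * v)
        (at s within {1 / 2..})"
      by (rule has_field_derivative_at_within) (auto intro!: derivative_eq_intros)
    have "\<bar>v\<bar> * std_normal_density (s * v) \<le> (2 * \<bar>s * v\<bar>) * std_normal_density (s * v)"
      using s by (intro mult_right_mono) (use mult_right_mono[of 1 "2 * \<bar>s\<bar>" "\<bar>v\<bar>"] in \<open>auto simp: abs_mult\<close>)
    also have "\<dots> \<le> 2" using abs_mult_std_normal_density_le_1[of "s * v"] by simp
    finally show "norm (std_normal_density (s * v) * v) \<le> 2" by (simp add: abs_mult mult.commute)
  qed (use assms in auto)
  ultimately show ?thesis by simp
qed

section \<open>Independence from characteristic functions\<close>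

text \<open>By Levy's uniqueness theorem, the image under \<open>X\<close> of the probability measure with density
  \<open>f / c\<close> is the law of \<open>X\<close>.\<close>

lemma (in prob_space) expectation_indicator_char_factor:
  fixes X f :: "'a \<Rightarrow> real"
  assumes [measurable]: "random_variable borel X" "random_variable borel f"
    and f: "\<And>\<omega>. 0 \<le> f \<omega>" "\<And>\<omega>. f \<omega> \<le> d" and c: "expectation f = c" "0 < c"
    and char: "\<And>s. expectation (\<lambda>\<omega>. f \<omega> *\<^sub>R iexp (s * X \<omega>)) = c *\<^sub>R char (distr M borel X) s"
    and [measurable]: "A \<in> sets borel"
  shows "expectation (\<lambda>\<omega>. f \<omega> * indicator A (X \<omega>)) = c * prob (X -` A \<inter> space M)"
proof -
  define D where "D = density M (\<lambda>\<omega>. ennreal (f \<omega> / c))"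
  have f_c: "0 \<le> f \<omega> / c" for \<omega> using f c by simp
  have int_f: "integrable M f"
    using f by (intro integrable_const_bound[of f d]) auto
  have sets_D [measurable_cong]: "sets D = sets M" and space_D: "space D = space M"
    by (simp_all add: D_def)
  have "emeasure D (space D) = (\<integral>\<^sup>+\<omega>. ennreal (f \<omega> / c) \<partial>M)"
    unfolding D_def by (simp add: emeasure_density cong: nn_integral_cong)
  also have "\<dots> = 1"
    using int_f f_c c by (subst nn_integral_eq_integral) auto
  finally interpret D: prob_space D by (rule prob_spaceI)
  have [measurable]: "X \<in> measurable D borel" by measurable
  interpret N: real_distribution "distr D borel X" by (rule D.real_distribution_distr) simp
  interpret \<mu>: real_distribution "distr M borel X" by (rule real_distribution_distr) simp
  have "Characteristic_Functions.char (distr D borel X) s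
      = Characteristic_Functions.char (distr M borel X) s" for s
  proof -
    have "Characteristic_Functions.char (distr D borel X) s = (CLINT \<omega>|D. iexp (s * X \<omega>))"
      unfolding char_def by (subst integral_distr) auto
    also have "\<dots> = (CLINT \<omega>|M. (f \<omega> / c) *\<^sub>R iexp (s * X \<omega>))"
      unfolding D_def using f_c by (intro integral_density) auto
    also have "\<dots> = (CLINT \<omega>|M. (1 / c) *\<^sub>R (f \<omega> *\<^sub>R iexp (s * X \<omega>)))"
      by simp
    also have "\<dots> = (1 / c) *\<^sub>R (CLINT \<omega>|M. f \<omega> *\<^sub>R iexp (s * X \<omega>))"
      by (rule integral_scaleR_right)
    finally show ?thesis using char c by simp
  qed
  hence eq: "distr D borel X = distr M borel X"
    by (intro Levy_uniqueness N.real_distribution_axioms \<mu>.real_distribution_axioms ext)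
  have "expectation (\<lambda>\<omega>. f \<omega> * indicator A (X \<omega>))
      = c * (\<integral>\<omega>. (f \<omega> / c) *\<^sub>R (indicator A (X \<omega>) :: real) \<partial>M)"
    using c by (subst integral_mult_right_zero[symmetric]) simp
  also have "(\<integral>\<omega>. (f \<omega> / c) *\<^sub>R (indicator A (X \<omega>) :: real) \<partial>M) = (\<integral>\<omega>. indicator A (X \<omega>) \<partial>D)"
    unfolding D_def using f_c by (intro integral_density[symmetric]) auto
  also have "\<dots> = (\<integral>x. indicator A x \<partial>distr D borel X)"
    by (subst integral_distr) auto
  also have "\<dots> = measure (distr M borel X) A" unfolding eq by simp
  also have "\<dots> = prob (X -` A \<inter> space M)" by (subst measure_distr) auto
  finally show ?thesis .
qed

text \<open>The previous lemma is applied to the positive weights \<open>2 + cos (t * Y + \<phi>)\<close> for \<open>\<phi> = 0\<close> and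
  \<open>\<phi> = - \<pi> / 2\<close>, which give the real and imaginary part of the characteristic function of \<open>Y\<close> on an
  event \<open>X \<in> A\<close>, and then to the weight \<open>1\<^sub>A X\<close> with the roles of \<open>X\<close> and \<open>Y\<close> exchanged.\<close>

lemma (in prob_space) indep_var_char:
  fixes X Y :: "'a \<Rightarrow> real"
  assumes [measurable]: "random_variable borel X" "random_variable borel Y"
    and char: "\<And>s t. expectation (\<lambda>\<omega>. iexp (s * X \<omega> + t * Y \<omega>))
      = char (distr M borel X) s * char (distr M borel Y) t"
  shows "indep_var borel X borel Y"
proof -
  interpret \<mu>: real_distribution "distr M borel X" by (rule real_distribution_distr) simp
  interpret \<nu>: real_distribution "distr M borel Y" by (rule real_distribution_distr) simp
  have I: "integrable M (\<lambda>\<omega>. iexp (g \<omega>))" if [measurable]: "g \<in> borel_measurable M" for g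
    by (rule integrable_iexp) auto
  have cos_int: "integrable M (\<lambda>\<omega>. cos (t * Y \<omega> + \<phi>))" for t \<phi>
    by (intro integrable_const_bound[of _ 1]) auto
  have char_cos: "expectation (\<lambda>\<omega>. cos (t * Y \<omega> + \<phi>) *\<^sub>R iexp (s * X \<omega>))
      = expectation (\<lambda>\<omega>. cos (t * Y \<omega> + \<phi>)) *\<^sub>R Characteristic_Functions.char (distr M borel X) s"
    for t \<phi> s
  proof -
    define J where "J = (\<lambda>s. expectation (\<lambda>\<omega>. cos (t * Y \<omega> + \<phi>) *\<^sub>R iexp (s * X \<omega>)))"
    \<comment> \<open>By Euler's formula \<open>J s\<close> splits into two joint characteristic
      functions, each of which factors; \<open>z\<close> is the part without \<open>s\<close>.
      Taking \<open>s = 0\<close> then identifies \<open>z\<close> as the mean of the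
      cosine.\<close>
    define z where "z = (iexp \<phi> * Characteristic_Functions.char (distr M borel Y) t
        + iexp (- \<phi>) * Characteristic_Functions.char (distr M borel Y) (- t)) / 2"
    have J: "J s = Characteristic_Functions.char (distr M borel X) s * z" for s
    proof -
      have "J s = expectation (\<lambda>\<omega>. (iexp \<phi> * iexp (s * X \<omega> + t * Y \<omega>)
          + iexp (- \<phi>) * iexp (s * X \<omega> + (- t) * Y \<omega>)) / 2)"
        unfolding J_def
      proof (intro Bochner_Integration.integral_cong refl)
        fix \<omega>
        have "cos (t * Y \<omega> + \<phi>) *\<^sub>R iexp (s * X \<omega>)
            = cos (complex_of_real (t * Y \<omega> + \<phi>)) * iexp (s * X \<omega>)"
          by (simp only: scaleR_conv_of_real cos_of_real)
        also have "\<dots> = (iexp \<phi> * iexp (s * X \<omega> + t * Y \<omega>)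
            + iexp (- \<phi>) * iexp (s * X \<omega> + (- t) * Y \<omega>)) / 2"
          by (simp add: cos_exp_eq exp_add[symmetric] algebra_simps add_divide_distrib
                exp_minus[symmetric])
        finally show "cos (t * Y \<omega> + \<phi>) *\<^sub>R iexp (s * X \<omega>) = \<dots>" .
      qed
      also have "\<dots> = (iexp \<phi> * expectation (\<lambda>\<omega>. iexp (s * X \<omega> + t * Y \<omega>))
          + iexp (- \<phi>) * expectation (\<lambda>\<omega>. iexp (s * X \<omega> + (- t) * Y \<omega>))) / 2"
      proof -
        have "integrable M (\<lambda>\<omega>. iexp (s * X \<omega> + t * Y \<omega>))"
          "integrable M (\<lambda>\<omega>. iexp (s * X \<omega> + (- t) * Y \<omega>))"
          by (rule I, measurable)+
        thus ?thesis
          by (simp only: integral_divide_zero Bochner_Integration.integral_add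
                integral_mult_right_zero integrable_mult_right)
      qed
      finally show ?thesis
        unfolding char z_def by (simp add: algebra_simps add_divide_distrib)
    qed
    have "complex_of_real (expectation (\<lambda>\<omega>. cos (t * Y \<omega> + \<phi>))) = J 0"
      unfolding J_def by (simp add: scaleR_conv_of_real flip: integral_of_real)
    also have "\<dots> = z" using J[of 0] by (simp add: \<mu>.char_zero)
    finally show ?thesis using J[of s] by (simp add: J_def scaleR_conv_of_real mult.commute)
  qed
  have ind_cos: "expectation (\<lambda>\<omega>. cos (t * Y \<omega> + \<phi>) * indicator A (X \<omega>))
      = expectation (\<lambda>\<omega>. cos (t * Y \<omega> + \<phi>)) * prob (X -` A \<inter> space M)"
    if [measurable]: "A \<in> sets borel" for t \<phi> A
  proof -
    define c where "c = expectation (\<lambda>\<omega>. cos (t * Y \<omega> + \<phi>))"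
    have "expectation (\<lambda>\<omega>. - 1) \<le> c"
      unfolding c_def by (intro integral_mono cos_int) auto
    hence "- 1 \<le> c" by (simp add: prob_space)
    have int_ind: "integrable M (\<lambda>\<omega>. indicator A (X \<omega>) :: real)"
      by (intro integrable_const_bound[of _ 1]) auto
    have int_cos_ind: "integrable M (\<lambda>\<omega>. cos (t * Y \<omega> + \<phi>) * indicator A (X \<omega>))"
      by (intro integrable_const_bound[of _ 1]) (auto simp: indicator_def)
    \<comment> \<open>The offset 2 leaves a weight of mean at least 1. With offset 1 the mean could
      be 0, and no probability density could be formed. The contribution of the constant is
      subtracted afterwards.\<close>
    have "expectation (\<lambda>\<omega>. (2 + cos (t * Y \<omega> + \<phi>)) * indicator A (X \<omega>))
        = (2 + c) * prob (X -` A \<inter> space M)"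
    proof (rule expectation_indicator_char_factor[where d = 3])
      show "0 \<le> 2 + cos (t * Y \<omega> + \<phi>)" "2 + cos (t * Y \<omega> + \<phi>) \<le> 3" for \<omega>
        using cos_ge_minus_one[of "t * Y \<omega> + \<phi>"] cos_le_one[of "t * Y \<omega> + \<phi>"] by linarith+
      show "expectation (\<lambda>\<omega>. 2 + cos (t * Y \<omega> + \<phi>)) = 2 + c"
        unfolding c_def by (subst Bochner_Integration.integral_add) (auto simp: cos_int prob_space)
      have int_c: "integrable M (\<lambda>\<omega>. cos (t * Y \<omega> + \<phi>) *\<^sub>R iexp (s * X \<omega>))" for s
        by (intro integrable_const_bound[of _ 1]) auto
      show "expectation (\<lambda>\<omega>. (2 + cos (t * Y \<omega> + \<phi>)) *\<^sub>R iexp (s * X \<omega>))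
          = (2 + c) *\<^sub>R Characteristic_Functions.char (distr M borel X) s" for s
      proof -
        have "expectation (\<lambda>\<omega>. (2 + cos (t * Y \<omega> + \<phi>)) *\<^sub>R iexp (s * X \<omega>))
          = expectation (\<lambda>\<omega>. 2 *\<^sub>R iexp (s * X \<omega>))
            + expectation (\<lambda>\<omega>. cos (t * Y \<omega> + \<phi>) *\<^sub>R iexp (s * X \<omega>))"
          unfolding scaleR_add_left
          by (intro Bochner_Integration.integral_add integrable_scaleR_right int_c I) auto
        also have "expectation (\<lambda>\<omega>. 2 *\<^sub>R iexp (s * X \<omega>))
            = 2 *\<^sub>R Characteristic_Functions.char (distr M borel X) s"
          unfolding char_def by (subst integral_distr) auto
        finally show ?thesis unfolding char_cos c_def by (simp only: scaleR_add_left)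
      qed
    qed (use \<open>- 1 \<le> c\<close> in auto)
    moreover have "expectation (\<lambda>\<omega>. (2 + cos (t * Y \<omega> + \<phi>)) * indicator A (X \<omega>))
        = 2 * expectation (\<lambda>\<omega>. indicator A (X \<omega>))
          + expectation (\<lambda>\<omega>. cos (t * Y \<omega> + \<phi>) * indicator A (X \<omega>))"
      unfolding distrib_right
      by (subst Bochner_Integration.integral_add) (auto intro!: int_ind int_cos_ind)
    moreover have "expectation (\<lambda>\<omega>. indicator A (X \<omega>)) = prob (X -` A \<inter> space M)"
    proof -
      have "expectation (\<lambda>\<omega>. indicator A (X \<omega>)) = measure (distr M borel X) A"
        by (subst integral_distr[of X M borel, symmetric]) auto
      thus ?thesis by (subst (asm) measure_distr) auto
    qed
    ultimately show ?thesis unfolding c_def by (simp add: algebra_simps)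
  qed
  have prod: "prob ((X -` A \<inter> space M) \<inter> (Y -` B \<inter> space M))
      = prob (X -` A \<inter> space M) * prob (Y -` B \<inter> space M)"
    if [measurable]: "A \<in> sets borel" "B \<in> sets borel" for A B
  \<comment> \<open>An event of probability 0 cannot be turned into a normalized density, so it is
    treated apart.\<close>
  proof (cases "prob (X -` A \<inter> space M) = 0")
    case True
    moreover have "prob ((X -` A \<inter> space M) \<inter> (Y -` B \<inter> space M)) \<le> prob (X -` A \<inter> space M)"
      by (intro finite_measure_mono) auto
    ultimately show ?thesis by (simp add: measure_le_0_iff)
  next
    case False
    define c where "c = prob (X -` A \<inter> space M)"
    have exp_ind: "expectation (\<lambda>\<omega>. indicator A (X \<omega>)) = c"
      using ind_cos[OF that(1), of 0 0] by (simp add: c_def prob_space)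
    have "expectation (\<lambda>\<omega>. indicator A (X \<omega>) * indicator B (Y \<omega>)) = c * prob (Y -` B \<inter> space M)"
    proof (rule expectation_indicator_char_factor[where d = 1])
      show "expectation (\<lambda>\<omega>. indicator A (X \<omega>) *\<^sub>R iexp (t * Y \<omega>))
          = c *\<^sub>R Characteristic_Functions.char (distr M borel Y) t" for t
      proof (rule complex_eqI)
        have int: "integrable M (\<lambda>\<omega>. indicator A (X \<omega>) *\<^sub>R iexp (t * Y \<omega>))"
          by (intro integrable_const_bound[of _ 1]) (auto simp: indicator_def)
        have char_Y: "Characteristic_Functions.char (distr M borel Y) t
            = expectation (\<lambda>\<omega>. iexp (t * Y \<omega>))"
          unfolding char_def by (subst integral_distr) auto
        have int_Y: "integrable M (\<lambda>\<omega>. iexp (t * Y \<omega>))" by (rule I) simp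
        show "Re (expectation (\<lambda>\<omega>. indicator A (X \<omega>) *\<^sub>R iexp (t * Y \<omega>)))
            = Re (c *\<^sub>R Characteristic_Functions.char (distr M borel Y) t)"
          using ind_cos[OF that(1), of t 0]
          unfolding char_Y scaleR_complex.sel integral_Re[OF int, symmetric]
            integral_Re[OF int_Y, symmetric]
          by (simp add: Re_exp c_def mult.commute)
        show "Im (expectation (\<lambda>\<omega>. indicator A (X \<omega>) *\<^sub>R iexp (t * Y \<omega>)))
            = Im (c *\<^sub>R Characteristic_Functions.char (distr M borel Y) t)"
          using ind_cos[OF that(1), of t "- (pi / 2)"]
          unfolding char_Y scaleR_complex.sel integral_Im[OF int, symmetric]
            integral_Im[OF int_Y, symmetric]
          by (simp add: Im_exp c_def mult.commute cos_diff)
      qed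
    qed (use False in \<open>auto simp: exp_ind c_def zero_less_measure_iff indicator_le_1\<close>)
    moreover have "expectation (\<lambda>\<omega>. indicator A (X \<omega>) * indicator B (Y \<omega>) :: real)
        = expectation (indicator ((X -` A \<inter> space M) \<inter> (Y -` B \<inter> space M)))"
      by (intro Bochner_Integration.integral_cong) (auto simp: indicator_def)
    ultimately show ?thesis by (simp add: c_def)
  qed
  show ?thesis
    unfolding indep_var_distribution_eq
  proof (intro conjI)
    interpret P: pair_prob_space "distr M borel X" "distr M borel Y" ..
    show "distr M borel X \<Otimes>\<^sub>M distr M borel Y = distr M (borel \<Otimes>\<^sub>M borel) (\<lambda>x. (X x, Y x))"
    proof (rule pair_measure_eqI)
      fix A B assume AB: "A \<in> sets (distr M borel X)" "B \<in> sets (distr M borel Y)"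
      hence [measurable]: "A \<in> sets borel" "B \<in> sets borel" by auto
      have "(\<lambda>x. (X x, Y x)) -` (A \<times> B) \<inter> space M = (X -` A \<inter> space M) \<inter> (Y -` B \<inter> space M)"
        by auto
      thus "emeasure (distr M borel X) A * emeasure (distr M borel Y) B
          = emeasure (distr M (borel \<Otimes>\<^sub>M borel) (\<lambda>x. (X x, Y x))) (A \<times> B)"
        by (simp add: emeasure_distr emeasure_eq_measure prod ennreal_mult)
    qed (auto simp: \<mu>.sigma_finite_measure_axioms \<nu>.sigma_finite_measure_axioms
          intro: sets_pair_measure_cong)
  qed auto
qed

section \<open>Centred normal laws\<close>

text \<open>Writing every centred normal law as a rescaled standard one covers the point mass at
  \<open>s = 0\<close> and negative \<open>s\<close> as well, since the density sees only the square
  of \<open>s\<close>. Later arguments thus avoid a case distinction on degenerate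
  variances.\<close>

lemma normal_law_0_eq_distr:
  "normal_law 0 s = distr std_normal_distribution borel (\<lambda>x. s * x)"
proof (cases "s = 0")
  case True
  thus ?thesis by (simp add: normal_law_def std_normal.distr_const)
next
  case False
  have "distributed std_normal_distribution lborel (\<lambda>x. x) std_normal_density"
    unfolding distributed_def by (auto intro!: distr_id2)
  from std_normal.normal_density_affine[OF this _ False, of 0]
  have "distributed std_normal_distribution lborel (\<lambda>x. s * x) (normal_density 0 \<bar>s\<bar>)"
    by simp
  hence "distr std_normal_distribution lborel (\<lambda>x. s * x) = density lborel (normal_density 0 \<bar>s\<bar>)"
    by (simp add: distributed_def)
  moreover have "normal_density 0 \<bar>s\<bar> = normal_density 0 s"
    by (auto simp: normal_density_def)
  moreover have "distr std_normal_distribution borel (\<lambda>x. s * x)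
      = distr std_normal_distribution lborel (\<lambda>x. s * x)"
    by (rule distr_cong) auto
  ultimately show ?thesis using False by (simp add: normal_law_def)
qed

lemma sets_normal_law [simp, measurable_cong]: "sets (normal_law m s) = sets borel"
  by (simp add: normal_law_def)

lemma real_distribution_normal_law: "real_distribution (normal_law 0 s)"
  unfolding normal_law_0_eq_distr by (rule std_normal.real_distribution_distr) simp

lemma char_normal_law: "char (normal_law 0 s) t = exp (- (s * t)\<^sup>2 / 2)"
proof -
  have "char (normal_law 0 s) t = (CLINT x|std_normal_distribution. iexp ((s * t) * x))"
    unfolding char_def normal_law_0_eq_distr by (subst integral_distr) (auto simp: mult_ac)
  also have "\<dots> = char std_normal_distribution (s * t)" by (simp only: char_def)
  finally show ?thesis by (simp only: char_std_normal_distribution)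
qed

lemma integrable_normal_law_abs_power: "integrable (normal_law 0 s) (\<lambda>u. \<bar>u\<bar> ^ k)"
proof -
  have "integrable std_normal_distribution (\<lambda>x. \<bar>x\<bar> ^ k)"
    by (subst integrable_density) (auto simp: integrable_std_normal_moment_abs)
  hence "integrable std_normal_distribution (\<lambda>x. \<bar>s * x\<bar> ^ k)"
    by (simp only: abs_mult power_mult_distrib integrable_mult_right)
  thus ?thesis
    unfolding normal_law_0_eq_distr by (subst integrable_distr_eq) auto
qed

text \<open>The probit loss grows quadratically in \<open>u\<close>: exponent 2 gives its mean,
  exponent 4 its second moment.\<close>

lemma integrable_normal_law_poly_bound:
  assumes [measurable]: "f \<in> borel_measurable borel" and "\<And>u. \<bar>f u\<bar> \<le> C * (1 + \<bar>u\<bar>) ^ k"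
  shows "integrable (normal_law 0 s) (f :: real \<Rightarrow> real)"
proof (rule Bochner_Integration.integrable_bound)
  have "C * (1 + \<bar>u\<bar>) ^ k = (\<Sum>j\<le>k. C * of_nat (k choose j) * \<bar>u\<bar> ^ j)" for u :: real
    using binomial_ring[of "\<bar>u\<bar>" 1 k] by (simp add: sum_distrib_left mult_ac add.commute)
  thus "integrable (normal_law 0 s) (\<lambda>u. C * (1 + \<bar>u\<bar>) ^ k)"
    by (simp add: integrable_normal_law_abs_power)
  have "norm (f u) \<le> norm (C * (1 + \<bar>u\<bar>) ^ k)" for u
    using assms(2)[of u] by (simp only: real_norm_def)
  thus "AE u in normal_law 0 s. norm (f u) \<le> norm (C * (1 + \<bar>u\<bar>) ^ k)" by simp
qed measurable

text \<open>With \<open>X\<close> and \<open>Z\<close> independent standard normal, the left-hand side is the probability that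
  \<open>X - \<beta> Z \<le> \<alpha>\<close>.\<close>

lemma integral_Phi_affine:
  "(\<integral>z. Phi (\<alpha> + \<beta> * z) \<partial>std_normal_distribution) = Phi (\<alpha> / sqrt (1 + \<beta>\<^sup>2))"
proof -
  define N :: "real measure" where "N = std_normal_distribution"
  interpret N: real_distribution N unfolding N_def by (rule real_dist_normal_dist)
  interpret P: pair_prob_space N N ..
  define P where "P = N \<Otimes>\<^sub>M N"
  have sets_N [measurable_cong]: "sets N = sets borel" by (simp add: N_def)
  have sets_P [measurable_cong]: "sets P = sets (borel \<Otimes>\<^sub>M borel)"
    unfolding P_def by (intro sets_pair_measure_cong sets_N)
  interpret PP: prob_space P unfolding P_def by (rule P.prob_space_axioms)
  have space_P: "space P = UNIV" by (simp add: P_def space_pair_measure)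
  have fst_P: "distr P borel fst = N"
  proof -
    have "distr P borel fst = distr P N fst" by (rule distr_cong) (auto simp: sets_N)
    thus ?thesis unfolding P_def by (simp add: N.distr_pair_fst)
  qed
  have snd_P: "distr P borel snd = N"
  proof -
    have "distr P borel snd = distr P N snd" by (rule distr_cong) (auto simp: sets_N)
    also have "\<dots> = N"
      unfolding P_def by (subst P.distr_pair_swap) 
        (simp add: distr_distr comp_def case_prod_beta N.distr_pair_fst)
    finally show ?thesis .
  qed
  have indep: "PP.indep_var borel fst borel snd"
    unfolding PP.indep_var_distribution_eq fst_P snd_P
  proof (intro conjI)
    have "distr P (borel \<Otimes>\<^sub>M borel) (\<lambda>p. (fst p, snd p)) = P"
      by (simp add: distr_id2[OF sets_P[symmetric]])
    thus "N \<Otimes>\<^sub>M N = distr P (borel \<Otimes>\<^sub>M borel) (\<lambda>p. (fst p, snd p))" by (simp add: P_def)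
  qed measurable
  define T where "T = (\<lambda>p :: real \<times> real. fst p + (- \<beta>) * snd p)"
  have [measurable]: "T \<in> borel_measurable P" unfolding T_def by measurable
  define s where "s = sqrt (1 + \<beta>\<^sup>2)"
  have s: "s > 0" "s\<^sup>2 = 1 + \<beta>\<^sup>2" by (auto simp: s_def add_pos_nonneg)
  have law_T: "distr P borel T = normal_law 0 s"
  proof (rule Levy_uniqueness)
    show "real_distribution (distr P borel T)" by (rule PP.real_distribution_distr) measurable
    show "real_distribution (normal_law 0 s)" by (rule real_distribution_normal_law)
    show "Characteristic_Functions.char (distr P borel T)
        = Characteristic_Functions.char (normal_law 0 s)"
    proof
      fix t
      have indep': "PP.indep_var borel fst borel (\<lambda>p. (- \<beta>) * snd p)"
        using PP.indep_var_compose[OF indep, of "\<lambda>x. x" borel "\<lambda>x. (- \<beta>) * x" borel]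
        by (simp add: comp_def)
      have "distr P borel (\<lambda>p. (- \<beta>) * snd p) = distr (distr P borel snd) borel (\<lambda>x. (- \<beta>) * x)"
        by (subst distr_distr) (auto simp: comp_def)
      also have "\<dots> = normal_law 0 (- \<beta>)"
        unfolding snd_P normal_law_0_eq_distr N_def by (intro distr_cong) auto
      finally have "Characteristic_Functions.char (distr P borel T) t
          = Characteristic_Functions.char N t * Characteristic_Functions.char (normal_law 0 (- \<beta>)) t"
        unfolding T_def PP.char_distr_add[OF indep'] fst_P by simp
      also have "\<dots> = Characteristic_Functions.char (normal_law 0 s) t"
        unfolding N_def char_std_normal_distribution char_normal_law power_mult_distrib s(2)
        by (simp add: algebra_simps add_divide_distrib diff_divide_distrib flip: exp_add of_real_mult)
      finally show "Characteristic_Functions.char (distr P borel T) t = \<dots>" .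
    qed
  qed
  have "ennreal (\<integral>z. Phi (\<alpha> + \<beta> * z) \<partial>N) = (\<integral>\<^sup>+z. ennreal (Phi (\<alpha> + \<beta> * z)) \<partial>N)"
    by (intro nn_integral_eq_integral[symmetric] N.integrable_const_bound[of _ 1] AE_I2)
       (auto simp: less_imp_le sets_N)
  \<comment> \<open>The section at \<open>z\<close> of the half plane
    \<open>T \<le> \<alpha>\<close> is the half line up to \<open>\<alpha> + \<beta> * z\<close>;
    integrating its measure gives the product measure of the half plane.\<close>
  also have "\<dots> = (\<integral>\<^sup>+z. emeasure N ((\<lambda>x. (x, z)) -` (T -` {..\<alpha>} \<inter> space P)) \<partial>N)"
  proof (intro nn_integral_cong)
    fix z
    have "(\<lambda>x. (x, z)) -` (T -` {..\<alpha>} \<inter> space P) = {..\<alpha> + \<beta> * z}"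
      by (auto simp: T_def space_P)
    thus "ennreal (Phi (\<alpha> + \<beta> * z)) = emeasure N ((\<lambda>x. (x, z)) -` (T -` {..\<alpha>} \<inter> space P))"
      by (simp add: cdf_def N_def std_normal.emeasure_eq_measure)
  qed
  also have "\<dots> = emeasure P (T -` {..\<alpha>} \<inter> space P)"
  proof -
    have "T -` {..\<alpha>} \<inter> space P \<in> sets P" by measurable
    thus ?thesis unfolding P_def by (rule P.emeasure_pair_measure_alt2[symmetric])
  qed
  also have "\<dots> = emeasure (distr P borel T) {..\<alpha>}" by (subst emeasure_distr) auto
  also have "\<dots> = emeasure N ((\<lambda>x. s * x) -` {..\<alpha>} \<inter> space N)"
    unfolding law_T normal_law_0_eq_distr N_def by (subst emeasure_distr) auto
  also have "(\<lambda>x. s * x) -` {..\<alpha>} \<inter> space N = {..\<alpha> / s}"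
    using s by (auto simp: N_def field_simps)
  also have "emeasure N {..\<alpha> / s} = ennreal (Phi (\<alpha> / s))"
    by (simp add: cdf_def N_def std_normal.emeasure_eq_measure)
  finally show ?thesis
    by (simp add: s_def N_def less_imp_le integral_nonneg_AE)
qed

section \<open>Consistency of M-estimators\<close>

text \<open>Independent centred variables are uncorrelated, so in the expanded square only the
  diagonal survives.\<close>

lemma (in prob_space) second_moment_sum_indep:
  fixes X :: "nat \<Rightarrow> 'a \<Rightarrow> real"
  assumes ind: "indep_vars (\<lambda>_. borel) X UNIV"
    and sq: "\<And>i. integrable M (\<lambda>\<omega>. (X i \<omega>)\<^sup>2)"
    and mean: "\<And>i. expectation (X i) = 0"
  shows "integrable M (\<lambda>\<omega>. (\<Sum>i<n. X i \<omega>)\<^sup>2)"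
    and "expectation (\<lambda>\<omega>. (\<Sum>i<n. X i \<omega>)\<^sup>2) = (\<Sum>i<n. expectation (\<lambda>\<omega>. (X i \<omega>)\<^sup>2))"
proof -
  have [measurable]: "X i \<in> borel_measurable M" for i
    using ind unfolding indep_vars_def by auto
  have int: "integrable M (X i)" for i
    by (rule square_integrable_imp_integrable[OF _ sq]) simp
  have cross: "integrable M (\<lambda>\<omega>. X i \<omega> * X j \<omega>) \<and> expectation (\<lambda>\<omega>. X i \<omega> * X j \<omega>) = 0"
    if "i \<noteq> j" for i j
  proof -
    have "indep_vars (\<lambda>_. borel) X {i, j}"
      by (rule indep_vars_subset[OF ind]) auto
    thus ?thesis
      using indep_vars_integrable[of "{i, j}" X] indep_vars_lebesgue_integral[of "{i, j}" X] that int mean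
      by auto
  qed
  have "integrable M (\<lambda>\<omega>. X i \<omega> * X j \<omega>)" for i j
    using cross[of i j] sq[of i] by (cases "i = j") (auto simp: power2_eq_square)
  note I = this
  have eq: "(\<Sum>i<n. X i \<omega>)\<^sup>2 = (\<Sum>i<n. \<Sum>j<n. X i \<omega> * X j \<omega>)" for \<omega>
    by (simp add: power2_eq_square sum_product)
  show "integrable M (\<lambda>\<omega>. (\<Sum>i<n. X i \<omega>)\<^sup>2)"
    unfolding eq by (intro Bochner_Integration.integrable_sum I)
  have "expectation (\<lambda>\<omega>. (\<Sum>i<n. X i \<omega>)\<^sup>2) = (\<Sum>i<n. \<Sum>j<n. expectation (\<lambda>\<omega>. X i \<omega> * X j \<omega>))"
    unfolding eq by (simp add: I)
  also have "\<dots> = (\<Sum>i<n. \<Sum>j<n. if j = i then expectation (\<lambda>\<omega>. (X i \<omega>)\<^sup>2) else 0)"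
    by (intro sum.cong refl) (use cross in \<open>auto simp: power2_eq_square\<close>)
  also have "\<dots> = (\<Sum>i<n. expectation (\<lambda>\<omega>. (X i \<omega>)\<^sup>2))"
    by (intro sum.cong refl) (simp add: sum.delta)
  finally show "expectation (\<lambda>\<omega>. (\<Sum>i<n. X i \<omega>)\<^sup>2) = (\<Sum>i<n. expectation (\<lambda>\<omega>. (X i \<omega>)\<^sup>2))" .
qed

text \<open>Chebyshev's inequality. Asking for a common mean and a uniform bound on the second
  moments avoids comparing the laws of the \<open>X i\<close>.\<close>

lemma (in prob_space) weak_law_of_large_numbers:
  fixes X :: "nat \<Rightarrow> 'a \<Rightarrow> real"
  assumes ind: "indep_vars (\<lambda>_. borel) X UNIV"
    and sq: "\<And>i. integrable M (\<lambda>\<omega>. (X i \<omega>)\<^sup>2)"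
    and mean: "\<And>i. expectation (X i) = \<mu>"
    and bound: "\<And>i. expectation (\<lambda>\<omega>. (X i \<omega>)\<^sup>2) \<le> C"
    and "0 < \<epsilon>"
  shows "(\<lambda>n. prob {\<omega> \<in> space M. \<epsilon> \<le> \<bar>(\<Sum>i<n. X i \<omega>) / n - \<mu>\<bar>}) \<longlonglongrightarrow> 0"
proof -
  have [measurable]: "X i \<in> borel_measurable M" for i
    using ind unfolding indep_vars_def by auto
  have int: "integrable M (X i)" for i
    by (rule square_integrable_imp_integrable[OF _ sq]) simp
  define Y where "Y = (\<lambda>i \<omega>. X i \<omega> - \<mu>)"
  have [measurable]: "Y i \<in> borel_measurable M" for i unfolding Y_def by simp
  have indY: "indep_vars (\<lambda>_. borel) Y UNIV"
    unfolding Y_def by (rule indep_vars_compose2[OF ind]) auto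
  have sqeq: "(Y i \<omega>)\<^sup>2 = (X i \<omega>)\<^sup>2 - 2 * \<mu> * X i \<omega> + \<mu>\<^sup>2" for i \<omega>
    by (simp add: Y_def power2_eq_square algebra_simps)
  have sqY: "integrable M (\<lambda>\<omega>. (Y i \<omega>)\<^sup>2)" for i
    unfolding sqeq using int sq by simp
  have meanY: "expectation (Y i) = 0" for i
    using int[of i] mean[of i] by (simp add: Y_def prob_space)
  have boundY: "expectation (\<lambda>\<omega>. (Y i \<omega>)\<^sup>2) \<le> C" for i
  proof -
    have "expectation (\<lambda>\<omega>. (Y i \<omega>)\<^sup>2) = expectation (\<lambda>\<omega>. (X i \<omega>)\<^sup>2) - \<mu>\<^sup>2"
      unfolding sqeq using int[of i] sq[of i] mean[of i]
      by (simp add: prob_space power2_eq_square)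
    thus ?thesis using bound[of i] zero_le_power2[of \<mu>] by linarith
  qed
  \<comment> \<open>At \<open>n = 0\<close> both the average and the right-hand side are 0 by the
    convention for division, while the probability is 1 if
    \<open>\<epsilon> \<le> \<bar>\<mu>\<bar>\<close>; hence the restriction to positive
    \<open>n\<close>.\<close>
  have le: "prob {\<omega> \<in> space M. \<epsilon> \<le> \<bar>(\<Sum>i<n. X i \<omega>) / n - \<mu>\<bar>} \<le> C / \<epsilon>\<^sup>2 / n" if "n > 0" for n
  proof -
    have eq: "(\<Sum>i<n. X i \<omega>) / n - \<mu> = (\<Sum>i<n. Y i \<omega>) / n" for \<omega>
      using that by (simp add: Y_def sum_subtractf field_simps)
    have "{\<omega> \<in> space M. \<epsilon> \<le> \<bar>(\<Sum>i<n. X i \<omega>) / n - \<mu>\<bar>}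
        = {\<omega> \<in> space M. (\<epsilon> * n)\<^sup>2 \<le> (\<Sum>i<n. Y i \<omega>)\<^sup>2}"
      unfolding eq using that \<open>0 < \<epsilon>\<close>
      by (auto simp: abs_le_square_iff[symmetric] pos_le_divide_eq abs_mult)
    also have "prob \<dots> \<le> expectation (\<lambda>\<omega>. (\<Sum>i<n. Y i \<omega>)\<^sup>2) / (\<epsilon> * n)\<^sup>2"
      using that \<open>0 < \<epsilon>\<close>
      by (intro integral_Markov_inequality_measure[where A = "space M"]
            second_moment_sum_indep[OF indY sqY meanY]) auto
    also have "\<dots> = (\<Sum>i<n. expectation (\<lambda>\<omega>. (Y i \<omega>)\<^sup>2)) / (\<epsilon> * n)\<^sup>2"
      by (subst second_moment_sum_indep[OF indY sqY meanY]) simp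
    also have "\<dots> \<le> (n * C) / (\<epsilon> * n)\<^sup>2"
      using sum_mono[of "{..<n}" "\<lambda>i. expectation (\<lambda>\<omega>. (Y i \<omega>)\<^sup>2)" "\<lambda>_. C"] boundY
      by (intro divide_right_mono) auto
    also have "\<dots> = C / \<epsilon>\<^sup>2 / n"
      using that \<open>0 < \<epsilon>\<close> by (simp add: power2_eq_square field_simps)
    finally show ?thesis .
  qed
  show ?thesis
  proof (rule tendsto_sandwich[OF _ _ tendsto_const lim_const_over_n])
    show "\<forall>\<^sub>F n in sequentially. prob {\<omega> \<in> space M. \<epsilon> \<le> \<bar>(\<Sum>i<n. X i \<omega>) / n - \<mu>\<bar>} \<le> C / \<epsilon>\<^sup>2 / n"
      using eventually_gt_at_top[of 0] by eventually_elim (rule le)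
  qed auto
qed

text \<open>Wald's argument. The Lipschitz bound replaces a uniform law of large numbers: on a small ball
  around a point \<open>q \<noteq> p0\<close>, the empirical risk stays close to its value at \<open>q\<close>, and finitely many
  such balls cover the part of \<open>H\<close> away from \<open>p0\<close>.\<close>

lemma (in prob_space) M_estimator_consistent:
  fixes Z :: "nat \<Rightarrow> 'a \<Rightarrow> 'b" and L :: "'p::metric_space \<Rightarrow> 'b \<Rightarrow> real"
    and est :: "nat \<Rightarrow> 'a \<Rightarrow> 'p"
  assumes H: "compact H" "p0 \<in> H"
    and lip: "\<And>p q z. p \<in> H \<Longrightarrow> q \<in> H \<Longrightarrow> \<bar>L p z - L q z\<bar> \<le> K z * dist p q"
    and L_meas [measurable]: "\<And>p i. (\<lambda>\<omega>. L p (Z i \<omega>)) \<in> borel_measurable M"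
    and K_meas [measurable]: "\<And>i. (\<lambda>\<omega>. K (Z i \<omega>)) \<in> borel_measurable M"
    and L_lim: "\<And>p \<epsilon>. p \<in> H \<Longrightarrow> 0 < \<epsilon> \<Longrightarrow>
      (\<lambda>n. prob {\<omega> \<in> space M. \<epsilon> \<le> \<bar>(\<Sum>i<n. L p (Z i \<omega>)) / n - risk p\<bar>}) \<longlonglongrightarrow> 0"
    and K_lim: "\<And>\<epsilon>. 0 < \<epsilon> \<Longrightarrow>
      (\<lambda>n. prob {\<omega> \<in> space M. \<epsilon> \<le> \<bar>(\<Sum>i<n. K (Z i \<omega>)) / n - k\<bar>}) \<longlonglongrightarrow> 0"
    and sep: "\<And>p. p \<in> H \<Longrightarrow> p \<noteq> p0 \<Longrightarrow> risk p0 < risk p"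
    and est_in: "\<And>n \<omega>. \<omega> \<in> space M \<Longrightarrow> est n \<omega> \<in> H"
    and est_min: "\<And>n \<omega>. \<omega> \<in> space M \<Longrightarrow>
      (\<Sum>i<n. L (est n \<omega>) (Z i \<omega>)) \<le> (\<Sum>i<n. L p0 (Z i \<omega>))"
    and "0 < \<epsilon>"
  shows "(\<lambda>n. prob {\<omega> \<in> space M. \<epsilon> \<le> dist (est n \<omega>) p0}) \<longlonglongrightarrow> 0"
proof -
  define D where "D = H - ball p0 \<epsilon>"
  define \<delta> where "\<delta> = (\<lambda>q. risk q - risk p0)"
  \<comment> \<open>Outside \<open>B3\<close> the averaged Lipschitz constant is below
    \<open>\<bar>k\<bar> + 1\<close>, so on the ball of radius \<open>r q\<close> the average loss
    drops by at most a quarter of the gap \<open>\<delta> q\<close>.\<close>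
  define r where "r = (\<lambda>q. \<delta> q / (4 * (\<bar>k\<bar> + 1)))"
  have "compact D" unfolding D_def by (intro compact_diff H open_ball)
  have D_H: "q \<in> H" and \<delta>_pos: "0 < \<delta> q" if "q \<in> D" for q
    using that sep[of q] \<open>0 < \<epsilon>\<close> by (cases "q = p0"; auto simp: D_def \<delta>_def)+
  have r_pos: "0 < r q" if "q \<in> D" for q
    using \<delta>_pos[OF that] by (simp add: r_def add_nonneg_pos)
  obtain C where C: "C \<subseteq> D" "finite C" "D \<subseteq> (\<Union>q\<in>C. ball q (r q))"
    by (rule compactE_image[OF \<open>compact D\<close>, of D "\<lambda>q. ball q (r q)"]) (use r_pos in auto)
  define avg where "avg = (\<lambda>f n \<omega>. (\<Sum>i<n. f (Z i \<omega>)) / real n)"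
  define B1 where "B1 = (\<lambda>q n. {\<omega> \<in> space M. \<delta> q / 4 \<le> \<bar>avg (L q) n \<omega> - risk q\<bar>})"
  define B2 where "B2 = (\<lambda>q n. {\<omega> \<in> space M. \<delta> q / 4 \<le> \<bar>avg (L p0) n \<omega> - risk p0\<bar>})"
  define B3 where "B3 = (\<lambda>n. {\<omega> \<in> space M. 1 \<le> \<bar>avg K n \<omega> - k\<bar>})"
  have [measurable]: "(\<lambda>\<omega>. avg (L q) n \<omega>) \<in> borel_measurable M"
      "(\<lambda>\<omega>. avg K n \<omega>) \<in> borel_measurable M" for q n
    unfolding avg_def by measurable
  have [measurable]: "B1 q n \<in> events" "B2 q n \<in> events" "B3 n \<in> events" for q n
    unfolding B1_def B2_def B3_def by measurable
  have cover: "{\<omega> \<in> space M. \<epsilon> \<le> dist (est n \<omega>) p0} \<subseteq> (\<Union>q\<in>C. B1 q n \<union> B2 q n \<union> B3 n)"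
    if "0 < n" for n
  proof
    fix \<omega> assume \<omega>: "\<omega> \<in> {\<omega> \<in> space M. \<epsilon> \<le> dist (est n \<omega>) p0}"
    define e where "e = est n \<omega>"
    have "e \<in> D" using \<omega> est_in by (auto simp: D_def e_def dist_commute)
    then obtain q where q: "q \<in> C" "dist q e < r q" using C by auto
    hence "q \<in> D" using C by auto
    show "\<omega> \<in> (\<Union>q\<in>C. B1 q n \<union> B2 q n \<union> B3 n)"
    proof (rule ccontr)
      assume "\<omega> \<notin> (\<Union>q\<in>C. B1 q n \<union> B2 q n \<union> B3 n)"
      with q have "\<omega> \<notin> B1 q n" "\<omega> \<notin> B2 q n" "\<omega> \<notin> B3 n" by blast+
      with \<omega> have *: "\<bar>avg (L q) n \<omega> - risk q\<bar> < \<delta> q / 4"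
          "\<bar>avg (L p0) n \<omega> - risk p0\<bar> < \<delta> q / 4" "\<bar>avg K n \<omega> - k\<bar> < 1"
        by (auto simp: B1_def B2_def B3_def not_le)
      have "L q (Z i \<omega>) - L e (Z i \<omega>) \<le> K (Z i \<omega>) * dist q e" for i
        using lip[of q e "Z i \<omega>"] D_H[OF \<open>q \<in> D\<close>] D_H[OF \<open>e \<in> D\<close>] by linarith
      hence "(\<Sum>i<n. L q (Z i \<omega>) - L e (Z i \<omega>)) \<le> (\<Sum>i<n. K (Z i \<omega>) * dist q e)"
        by (intro sum_mono)
      hence "((\<Sum>i<n. L q (Z i \<omega>)) - (\<Sum>i<n. L e (Z i \<omega>))) / n
          \<le> (\<Sum>i<n. K (Z i \<omega>)) * dist q e / n"
        by (intro divide_right_mono) (auto simp: sum_subtractf sum_distrib_right)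
      hence "avg (L q) n \<omega> - avg (L e) n \<omega> \<le> avg K n \<omega> * dist q e"
        by (simp add: avg_def diff_divide_distrib)
      also have "\<dots> \<le> (\<bar>k\<bar> + 1) * dist q e"
        using *(3) by (intro mult_right_mono) auto
      also have "\<dots> \<le> (\<bar>k\<bar> + 1) * r q"
        using q by (intro mult_left_mono) auto
      also have "\<dots> = \<delta> q / 4"
      proof -
        have "x * (d / (4 * x)) = d / 4" if "x \<noteq> 0" for x d :: real using that by simp
        moreover have "\<bar>k\<bar> + 1 \<noteq> 0" by linarith
        ultimately show ?thesis unfolding r_def by blast
      qed
      finally have "avg (L q) n \<omega> - avg (L e) n \<omega> \<le> \<delta> q / 4" .
      moreover have "avg (L e) n \<omega> \<le> avg (L p0) n \<omega>"
        using est_min[of \<omega> n] \<omega> by (auto simp: avg_def e_def divide_right_mono)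
      \<comment> \<open>Outside the three bad events the estimates chain to
        \<open>\<delta> q < 3 / 4 * \<delta> q\<close>: a quarter each from the deviation at
        \<open>q\<close>, the move from \<open>q\<close> to \<open>e\<close>, and the deviation at
        \<open>p0\<close>.\<close>
      ultimately show False
        using *(1,2) \<delta>_pos[OF \<open>q \<in> D\<close>] unfolding \<delta>_def abs_less_iff
        by (auto simp: field_simps)
    qed
  qed
  have "(\<lambda>n. \<Sum>q\<in>C. prob (B1 q n) + prob (B2 q n) + prob (B3 n)) \<longlonglongrightarrow> (\<Sum>q\<in>C. 0 + 0 + 0)"
    unfolding B1_def B2_def B3_def avg_def
    using C D_H \<delta>_pos H by (intro tendsto_sum tendsto_add L_lim K_lim) auto
  hence lim: "(\<lambda>n. \<Sum>q\<in>C. prob (B1 q n) + prob (B2 q n) + prob (B3 n)) \<longlonglongrightarrow> 0"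
    by (simp only: add_0 sum.neutral_const)
  have bound: "\<forall>\<^sub>F n in sequentially. prob {\<omega> \<in> space M. \<epsilon> \<le> dist (est n \<omega>) p0}
      \<le> (\<Sum>q\<in>C. prob (B1 q n) + prob (B2 q n) + prob (B3 n))"
    using eventually_gt_at_top[of 0]
  proof eventually_elim
    case (elim n)
    have "prob {\<omega> \<in> space M. \<epsilon> \<le> dist (est n \<omega>) p0} \<le> prob (\<Union>q\<in>C. B1 q n \<union> B2 q n \<union> B3 n)"
      using C by (intro finite_measure_mono cover elim sets.finite_UN) auto
    also have "\<dots> \<le> (\<Sum>q\<in>C. prob (B1 q n \<union> B2 q n \<union> B3 n))"
      using C by (intro finite_measure_subadditive_finite) auto
    also have "\<dots> \<le> (\<Sum>q\<in>C. prob (B1 q n) + prob (B2 q n) + prob (B3 n))"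
    proof (intro sum_mono)
      fix q
      show "prob (B1 q n \<union> B2 q n \<union> B3 n) \<le> prob (B1 q n) + prob (B2 q n) + prob (B3 n)"
        by (intro order_trans[OF measure_Un_le] add_right_mono measure_Un_le) auto
    qed
    finally show ?case .
  qed
  show ?thesis
    by (rule tendsto_sandwich[OF always_eventually[OF allI[OF measure_nonneg]] bound tendsto_const lim])
qed

section \<open>The data model\<close>

lemma cov_inner_combine:
  "cov_inner S (s *\<^sub>R u + t *\<^sub>R v) w = s * cov_inner S u w + t * cov_inner S v w"
  by (simp add: cov_inner_def inner_add_left)

lemma cov_inner_commute:
  assumes "cov_matrix S"
  shows "cov_inner S u v = cov_inner S v u"
proof -
  have "u \<bullet> (S *v v) = (u v* S) \<bullet> v" by (simp add: dot_lmul_matrix)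
  also have "u v* S = S *v u"
    using assms transpose_matrix_vector[of S u] by (simp add: cov_matrix_def)
  finally show ?thesis by (simp add: cov_inner_def inner_commute)
qed

lemma cov_norm_square: "cov_matrix S \<Longrightarrow> (cov_norm S u)\<^sup>2 = cov_inner S u u"
  by (simp add: cov_norm_def cov_matrix_def cov_inner_def)

lemma cov_norm_square_combine:
  assumes "cov_matrix S"
  shows "(cov_norm S (s *\<^sub>R u + t *\<^sub>R v))\<^sup>2
    = s\<^sup>2 * (cov_norm S u)\<^sup>2 + 2 * s * t * cov_inner S u v + t\<^sup>2 * (cov_norm S v)\<^sup>2"
  unfolding cov_norm_square[OF assms] cov_inner_combine
  unfolding cov_inner_commute[OF assms, of _ "s *\<^sub>R u + t *\<^sub>R v"] cov_inner_combine
  by (simp add: power2_eq_square algebra_simps cov_inner_commute[OF assms, of v u])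

text \<open>The combination \<open>s *\<^sub>R u + t *\<^sub>R v\<close> defines another projection
  of \<open>X\<close>, so its law is prescribed; orthogonality removes the cross term from its
  variance, and the joint characteristic function factors.\<close>

lemma (in prob_space) centered_gaussian_indep:
  assumes S: "cov_matrix S" and X: "centered_gaussian M X S" and orth: "cov_inner S u v = 0"
  shows "indep_var borel (\<lambda>\<omega>. u \<bullet> X \<omega>) borel (\<lambda>\<omega>. v \<bullet> X \<omega>)"
proof (rule indep_var_char)
  have X_meas [measurable]: "X \<in> borel_measurable M"
    and law: "distr M borel (\<lambda>\<omega>. w \<bullet> X \<omega>) = normal_law 0 (cov_norm S w)" for w
    using X by (auto simp: centered_gaussian_def)
  show "random_variable borel (\<lambda>\<omega>. u \<bullet> X \<omega>)" "random_variable borel (\<lambda>\<omega>. v \<bullet> X \<omega>)"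
    by measurable
  fix s t :: real
  let ?w = "s *\<^sub>R u + t *\<^sub>R v"
  have "expectation (\<lambda>\<omega>. iexp (s * (u \<bullet> X \<omega>) + t * (v \<bullet> X \<omega>)))
      = expectation (\<lambda>\<omega>. iexp (1 * (?w \<bullet> X \<omega>)))"
    by (simp add: inner_add_left)
  also have "\<dots> = Characteristic_Functions.char (distr M borel (\<lambda>\<omega>. ?w \<bullet> X \<omega>)) 1"
    unfolding char_def by (subst integral_distr) auto
  also have "\<dots> = exp (- (cov_norm S ?w)\<^sup>2 / 2)"
    unfolding law char_normal_law by simp
  also have "\<dots> = Characteristic_Functions.char (distr M borel (\<lambda>\<omega>. u \<bullet> X \<omega>)) s
      * Characteristic_Functions.char (distr M borel (\<lambda>\<omega>. v \<bullet> X \<omega>)) t"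
    unfolding law char_normal_law cov_norm_square_combine[OF S] orth
    by (simp add: power_mult_distrib field_simps flip: exp_add of_real_mult)
  finally show "expectation (\<lambda>\<omega>. iexp (s * (u \<bullet> X \<omega>) + t * (v \<bullet> X \<omega>))) = \<dots>" .
qed

lemma integral_Phi_affine_normal_law:
  "(\<integral>w. Phi (\<alpha> + \<beta> * w) \<partial>normal_law 0 \<tau>) = Phi (\<alpha> / sqrt (1 + (\<beta> * \<tau>)\<^sup>2))"
proof -
  have "(\<integral>w. Phi (\<alpha> + \<beta> * w) \<partial>normal_law 0 \<tau>)
      = (\<integral>z. Phi (\<alpha> + (\<beta> * \<tau>) * z) \<partial>std_normal_distribution)"
    unfolding normal_law_0_eq_distr by (subst integral_distr) (auto simp: mult_ac)
  thus ?thesis by (simp only: integral_Phi_affine)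
qed

text \<open>The component of \<open>w \<bullet> x\<close> that is uncorrelated with \<open>v \<bullet> x\<close> is independent of it and can be
  integrated out of the probit link.\<close>

lemma (in prob_space) expectation_probit_projection:
  fixes v w :: "real^'d" and D :: "real \<Rightarrow> real"
  assumes S: "cov_matrix S" and X: "centered_gaussian M x S"
    and w: "cov_norm S w = 1" and s: "s = cov_norm S v" "s \<noteq> 0"
    and c: "c = cov_inner S w v / s"
    and D [measurable]: "D \<in> borel_measurable borel" and int_D: "integrable (normal_law 0 s) D"
  shows "expectation (\<lambda>\<omega>. D (v \<bullet> x \<omega>) * Phi (a * (w \<bullet> x \<omega>) + b))
    = (\<integral>u. D u * Phi ((a * (c * (u / s)) + b) / sqrt (1 + a\<^sup>2 * (1 - c\<^sup>2))) \<partial>normal_law 0 s)"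
proof -
  have x_meas [measurable]: "x \<in> borel_measurable M"
    and law: "distr M borel (\<lambda>\<omega>. u \<bullet> x \<omega>) = normal_law 0 (cov_norm S u)" for u
    using X by (auto simp: centered_gaussian_def)
  \<comment> \<open>The residual of \<open>w\<close> after orthogonal projection onto
    \<open>v\<close> with respect to \<open>S\<close>; as \<open>w\<close> has norm 1, its variance
    is \<open>1 - c\<^sup>2\<close>, possibly 0. The factor 1 fits the lemmas on linear
    combinations.\<close>
  define w' where "w' = 1 *\<^sub>R w + (- (c / s)) *\<^sub>R v"
  define \<tau> where "\<tau> = cov_norm S w'"
  have c_s: "cov_inner S w v = c * s" using c s by simp
  have \<tau>: "\<tau>\<^sup>2 = 1 - c\<^sup>2"
    unfolding \<tau>_def w'_def cov_norm_square_combine[OF S] w c_s s(1)[symmetric]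
    using s(2) by (simp add: power2_eq_square field_simps)
  have "cov_inner S w' v = 0"
    unfolding w'_def cov_inner_combine c_s cov_norm_square[OF S, symmetric] s(1)[symmetric]
    using s(2) by (simp add: power2_eq_square)
  hence orth: "cov_inner S v w' = 0" using cov_inner_commute[OF S] by simp
  have split: "w \<bullet> x \<omega> = c * (v \<bullet> x \<omega> / s) + w' \<bullet> x \<omega>" for \<omega>
    by (simp add: w'_def inner_add_left inner_diff_left)
  interpret N: real_distribution "normal_law 0 s" by (rule real_distribution_normal_law)
  interpret N': real_distribution "normal_law 0 \<tau>" by (rule real_distribution_normal_law)
  interpret P: pair_prob_space "normal_law 0 s" "normal_law 0 \<tau>" ..
  have joint: "distr M (borel \<Otimes>\<^sub>M borel) (\<lambda>\<omega>. (v \<bullet> x \<omega>, w' \<bullet> x \<omega>)) = normal_law 0 s \<Otimes>\<^sub>M normal_law 0 \<tau>"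
    using centered_gaussian_indep[OF S X orth] unfolding indep_var_distribution_eq
    by (simp add: law s(1) \<tau>_def)
  define G where "G = (\<lambda>(u, z). D u * Phi (a * (c * (u / s) + z) + b))"
  have [measurable]: "G \<in> borel_measurable (borel \<Otimes>\<^sub>M borel)"
    unfolding G_def by measurable
  have G_le: "\<bar>G (u, z)\<bar> \<le> \<bar>D u\<bar>" for u z
    unfolding G_def by (simp add: abs_mult mult_left_le less_imp_le)
  have int_G: "integrable (normal_law 0 s \<Otimes>\<^sub>M normal_law 0 \<tau>) G"
  proof (rule P.Fubini_integrable)
    show "integrable (normal_law 0 s) (\<lambda>u. \<integral>z. norm (G (u, z)) \<partial>normal_law 0 \<tau>)"
    proof (rule Bochner_Integration.integrable_bound[OF int_D])
      have "norm (\<integral>z. norm (G (u, z)) \<partial>normal_law 0 \<tau>) \<le> norm (D u)" for u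
      proof -
        have "(\<integral>z. norm (G (u, z)) \<partial>normal_law 0 \<tau>) \<le> (\<integral>z. \<bar>D u\<bar> \<partial>normal_law 0 \<tau>)"
          using G_le[of u]
          by (intro integral_mono N'.integrable_const_bound[of _ "\<bar>D u\<bar>"]) auto
        thus ?thesis by (simp add: N'.prob_space[simplified])
      qed
      thus "AE u in normal_law 0 s. norm (\<integral>z. norm (G (u, z)) \<partial>normal_law 0 \<tau>) \<le> norm (D u)"
        by simp
    qed measurable
    show "AE u in normal_law 0 s. integrable (normal_law 0 \<tau>) (\<lambda>z. G (u, z))"
      using G_le by (intro AE_I2 N'.integrable_const_bound[of _ "\<bar>D u\<bar>" for u]) auto
  qed measurable
  have "expectation (\<lambda>\<omega>. D (v \<bullet> x \<omega>) * Phi (a * (w \<bullet> x \<omega>) + b))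
      = expectation (\<lambda>\<omega>. G (v \<bullet> x \<omega>, w' \<bullet> x \<omega>))"
    unfolding G_def by (simp only: split prod.case)
  also have "\<dots> = (\<integral>p. G p \<partial>distr M (borel \<Otimes>\<^sub>M borel) (\<lambda>\<omega>. (v \<bullet> x \<omega>, w' \<bullet> x \<omega>)))"
    by (subst integral_distr) auto
  also have "\<dots> = (\<integral>u. \<integral>z. G (u, z) \<partial>normal_law 0 \<tau> \<partial>normal_law 0 s)"
    unfolding joint by (rule P.integral_fst'[OF int_G, symmetric])
  also have "\<dots> = (\<integral>u. D u * Phi ((a * (c * (u / s)) + b) / sqrt (1 + a\<^sup>2 * (1 - c\<^sup>2))) \<partial>normal_law 0 s)"
  proof (intro Bochner_Integration.integral_cong refl)
    fix u
    have "(\<integral>z. G (u, z) \<partial>normal_law 0 \<tau>)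
        = D u * (\<integral>z. Phi ((a * (c * (u / s)) + b) + a * z) \<partial>normal_law 0 \<tau>)"
      unfolding G_def by (simp add: algebra_simps)
    thus "(\<integral>z. G (u, z) \<partial>normal_law 0 \<tau>)
        = D u * Phi ((a * (c * (u / s)) + b) / sqrt (1 + a\<^sup>2 * (1 - c\<^sup>2)))"
      by (simp only: integral_Phi_affine_normal_law power_mult_distrib \<tau>)
  qed
  finally show ?thesis .
qed

text \<open>Any \<open>G\<close> is affine in the label, with slope \<open>D\<close>; hence the
  label can be replaced by its conditional expectation given \<open>x\<close>, and the projection
  formula turns the result into an integral over the law of \<open>v \<bullet> x\<close>. In effect
  \<open>f u\<close> is the probability of True given \<open>v \<bullet> x = u\<close>.\<close>

lemma (in prob_space) data_model_expectation:
  fixes v w :: "real^'d" and G :: "real \<Rightarrow> bool \<Rightarrow> real"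
  assumes S: "cov_matrix S" and model: "data_model M S \<sigma> w x y"
    and \<sigma>: "\<And>t. \<sigma> t = Phi (a * t + b)"
    and w: "cov_norm S w = 1" and s: "s = cov_norm S v" "s \<noteq> 0"
    and c: "c = cov_inner S w v / s"
    and f: "\<And>u. f u = Phi ((a * (c * (u / s)) + b) / sqrt (1 + a\<^sup>2 * (1 - c\<^sup>2)))"
    and G_meas [measurable]: "\<And>l. (\<lambda>u. G u l) \<in> borel_measurable borel"
    and int_G: "\<And>l. integrable (normal_law 0 s) (\<lambda>u. G u l)"
  shows "integrable M (\<lambda>\<omega>. G (v \<bullet> x \<omega>) (y \<omega>))"
    and "expectation (\<lambda>\<omega>. G (v \<bullet> x \<omega>) (y \<omega>))
      = (\<integral>u. f u * G u True + (1 - f u) * G u False \<partial>normal_law 0 s)"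
proof -
  have X: "centered_gaussian M x S" and y_meas [measurable]: "y \<in> measurable M (count_space UNIV)"
    and cond: "AE \<omega> in M. real_cond_exp M (vimage_algebra (space M) x borel) (\<lambda>\<omega>. of_bool (y \<omega>)) \<omega>
        = \<sigma> (w \<bullet> x \<omega>)"
    using model by (auto simp: data_model_def)
  have x_meas [measurable]: "x \<in> borel_measurable M"
    and law: "distr M borel (\<lambda>\<omega>. v \<bullet> x \<omega>) = normal_law 0 s"
    using X by (auto simp: centered_gaussian_def s)
  define F where "F = vimage_algebra (space M) x borel"
  have "subalgebra M F"
    unfolding F_def subalgebra_def using x_meas
    by (auto simp: sets_vimage_algebra2 measurable_sets)
  then interpret F: finite_measure_subalgebra M F by unfold_locales
  have x_F [measurable]: "x \<in> measurable F borel"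
    unfolding F_def by (rule measurable_vimage_algebra1) auto
  define D where "D = (\<lambda>u. G u True - G u False)"
  have [measurable]: "D \<in> borel_measurable borel" unfolding D_def by measurable
  have int_D: "integrable (normal_law 0 s) D" unfolding D_def by (intro Bochner_Integration.integrable_diff int_G)
  have pull: "integrable M (\<lambda>\<omega>. h (v \<bullet> x \<omega>))"
      "expectation (\<lambda>\<omega>. h (v \<bullet> x \<omega>)) = (\<integral>u. h u \<partial>normal_law 0 s)"
    if "integrable (normal_law 0 s) h" and [measurable]: "h \<in> borel_measurable borel" for h :: "real \<Rightarrow> real"
    using that(1) unfolding law[symmetric]
    by (auto simp: integrable_distr_eq integral_distr)
  have eq: "G (v \<bullet> x \<omega>) (y \<omega>) = G (v \<bullet> x \<omega>) False + D (v \<bullet> x \<omega>) * of_bool (y \<omega>)" for \<omega>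
    by (simp add: D_def)
  have int_Dy: "integrable M (\<lambda>\<omega>. D (v \<bullet> x \<omega>) * of_bool (y \<omega>))"
    by (rule Bochner_Integration.integrable_bound[OF pull(1)[OF int_D]]) auto
  show "integrable M (\<lambda>\<omega>. G (v \<bullet> x \<omega>) (y \<omega>))"
    unfolding eq by (intro Bochner_Integration.integrable_add int_Dy pull int_G) measurable
  have "expectation (\<lambda>\<omega>. D (v \<bullet> x \<omega>) * of_bool (y \<omega>))
      = expectation (\<lambda>\<omega>. D (v \<bullet> x \<omega>) * real_cond_exp M F (\<lambda>\<omega>. of_bool (y \<omega>)) \<omega>)"
    by (rule F.real_cond_exp_intg(2)[symmetric, OF int_Dy]) measurable
  also have "\<dots> = expectation (\<lambda>\<omega>. D (v \<bullet> x \<omega>) * Phi (a * (w \<bullet> x \<omega>) + b))"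
  proof (rule integral_cong_AE)
    show "AE \<omega> in M. D (v \<bullet> x \<omega>) * real_cond_exp M F (\<lambda>\<omega>. of_bool (y \<omega>)) \<omega>
        = D (v \<bullet> x \<omega>) * Phi (a * (w \<bullet> x \<omega>) + b)"
      using cond unfolding F_def \<sigma> by eventually_elim simp
  qed measurable
  also have "\<dots> = (\<integral>u. D u * f u \<partial>normal_law 0 s)"
    unfolding f by (rule expectation_probit_projection[OF S X w s c _ int_D]) measurable
  finally have E: "expectation (\<lambda>\<omega>. D (v \<bullet> x \<omega>) * of_bool (y \<omega>)) = (\<integral>u. D u * f u \<partial>normal_law 0 s)" .
  have [measurable]: "f \<in> borel_measurable borel"
    unfolding f[abs_def] by measurable
  have f01: "\<bar>f u\<bar> \<le> 1" for u unfolding f by (simp add: less_imp_le)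
  have int_Df: "integrable (normal_law 0 s) (\<lambda>u. D u * f u)"
    by (rule Bochner_Integration.integrable_bound[OF int_D])
       (use f01 in \<open>auto simp: abs_mult mult_left_le\<close>)
  have "expectation (\<lambda>\<omega>. G (v \<bullet> x \<omega>) (y \<omega>))
      = (\<integral>u. G u False \<partial>normal_law 0 s) + (\<integral>u. D u * f u \<partial>normal_law 0 s)"
    unfolding eq E[symmetric] using pull[OF int_G[of False]] int_Dy by simp
  also have "\<dots> = (\<integral>u. G u False + D u * f u \<partial>normal_law 0 s)"
    using int_G int_Df by simp
  also have "\<dots> = (\<integral>u. f u * G u True + (1 - f u) * G u False \<partial>normal_law 0 s)"
    by (intro Bochner_Integration.integral_cong refl) (simp add: D_def algebra_simps)
  finally show "expectation (\<lambda>\<omega>. G (v \<bullet> x \<omega>) (y \<omega>))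
      = (\<integral>u. f u * G u True + (1 - f u) * G u False \<partial>normal_law 0 s)" .
qed

text \<open>\<open>ln r \<le> r - 1\<close> is applied to both likelihood ratios, and the linear
  bounds cancel. Strictness in one of the two is enough, and \<open>q / p\<close> differs from
  1.\<close>

lemma binary_cross_entropy_gt:
  fixes p q :: real
  assumes "0 < p" "p < 1" "0 < q" "q < 1" "p \<noteq> q"
  shows "p * - ln p + (1 - p) * - ln (1 - p) < p * - ln q + (1 - p) * - ln (1 - q)"
proof -
  have "ln (q / p) \<le> q / p - 1" "ln ((1 - q) / (1 - p)) \<le> (1 - q) / (1 - p) - 1"
    using assms by (auto intro!: ln_le_minus_one)
  moreover have "ln (q / p) \<noteq> q / p - 1"
    using ln_eq_minus_one[of "q / p"] assms by auto
  ultimately have "p * ln (q / p) < p * (q / p - 1)"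
      "(1 - p) * ln ((1 - q) / (1 - p)) \<le> (1 - p) * ((1 - q) / (1 - p) - 1)"
    using assms by auto
  moreover have "p * (q / p - 1) = q - p" "(1 - p) * ((1 - q) / (1 - p) - 1) = p - q"
    using assms by (auto simp: field_simps)
  ultimately show ?thesis
    using assms by (simp add: ln_div algebra_simps)
qed

section \<open>The probit loss\<close>

text \<open>By \<open>Phi_minus\<close> the label only flips the sign of the argument, so one
  estimate for \<open>neg_log_Phi\<close> serves both labels. The parameters form a pair so that the
  metric of the product space can be used.\<close>

definition probit_loss :: "real \<Rightarrow> real \<Rightarrow> real \<times> real \<Rightarrow> real \<times> bool \<Rightarrow> real" where
  "probit_loss a b p z =
     (let t = a * (fst p * fst z + snd p) + b in neg_log_Phi (if snd z then t else - t))"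

lemma probit_loss_simps:
  "probit_loss a b p (u, True) = neg_log_Phi (a * (fst p * u + snd p) + b)"
  "probit_loss a b p (u, False) = neg_log_Phi (- (a * (fst p * u + snd p) + b))"
  by (simp_all add: probit_loss_def)

lemma probit_loss_measurable [measurable]: "(\<lambda>u. probit_loss a b p (u, l)) \<in> borel_measurable borel"
  unfolding probit_loss_def Let_def by (cases l) simp_all

lemma abs_probit_arg_le:
  fixes a b A B u R :: real
  assumes "\<bar>A\<bar> \<le> R" "\<bar>B\<bar> \<le> R"
  shows "\<bar>a * (A * u + B) + b\<bar> \<le> (\<bar>a\<bar> * R + \<bar>b\<bar>) * (1 + \<bar>u\<bar>)"
proof -
  have "\<bar>A * u + B\<bar> \<le> R * \<bar>u\<bar> + R"
    using assms by (intro order_trans[OF abs_triangle_ineq] add_mono) (auto simp: abs_mult mult_right_mono)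
  hence "\<bar>a\<bar> * \<bar>A * u + B\<bar> \<le> \<bar>a\<bar> * (R * \<bar>u\<bar> + R)" by (intro mult_left_mono) auto
  moreover have "\<bar>a * (A * u + B) + b\<bar> \<le> \<bar>a\<bar> * \<bar>A * u + B\<bar> + \<bar>b\<bar>"
    using abs_triangle_ineq[of "a * (A * u + B)" b] by (simp add: abs_mult)
  moreover have "0 \<le> \<bar>b\<bar> * \<bar>u\<bar>" by simp
  moreover have "(\<bar>a\<bar> * R + \<bar>b\<bar>) * (1 + \<bar>u\<bar>) = \<bar>a\<bar> * (R * \<bar>u\<bar> + R) + \<bar>b\<bar> + \<bar>b\<bar> * \<bar>u\<bar>"
    by (simp add: algebra_simps)
  ultimately show ?thesis by linarith
qed

lemma abs_fst_le_norm: "\<bar>fst p\<bar> \<le> norm p" and abs_snd_le_norm: "\<bar>snd p\<bar> \<le> norm p"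
  for p :: "real \<times> real"
  using norm_fst_le[of "fst p" "snd p"] norm_snd_le[of "snd p" "fst p"] by simp_all

text \<open>One factor \<open>1 + \<bar>fst z\<bar>\<close> stems from the linear growth of the
  derivative of \<open>neg_log_Phi\<close>, the other from the dependence of its argument on the
  parameters.\<close>

lemma probit_loss_Lipschitz:
  assumes R: "norm p \<le> R" "norm q \<le> R"
  shows "\<bar>probit_loss a b p z - probit_loss a b q z\<bar>
    \<le> exp 2 * (1 + 2 * (\<bar>a\<bar> * R + \<bar>b\<bar>)) * \<bar>a\<bar> * (1 + \<bar>fst z\<bar>)\<^sup>2 * dist p q"
proof -
  define u where "u = fst z"
  define T where "T = (\<lambda>p :: real \<times> real. a * (fst p * u + snd p) + b)"
  have loss: "probit_loss a b p z = neg_log_Phi (if snd z then T p else - T p)" for p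
    by (simp add: probit_loss_def T_def u_def Let_def)
  define m where "m = \<bar>a\<bar> * R + \<bar>b\<bar>"
  note comp = abs_fst_le_norm abs_snd_le_norm
  have T_le: "\<bar>T p\<bar> \<le> m * (1 + \<bar>u\<bar>)" "\<bar>T q\<bar> \<le> m * (1 + \<bar>u\<bar>)"
    unfolding T_def m_def using R comp[of p] comp[of q] by (intro abs_probit_arg_le; linarith)+
  have "0 \<le> R" using R norm_ge_zero order_trans by blast
  hence m: "0 \<le> m" by (simp add: m_def)
  have "\<bar>T p - T q\<bar> = \<bar>a\<bar> * \<bar>(fst p - fst q) * u + (snd p - snd q)\<bar>"
    unfolding T_def by (simp add: abs_mult[symmetric] algebra_simps)
  also have "\<dots> \<le> \<bar>a\<bar> * (dist p q * \<bar>u\<bar> + dist p q)"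
    using comp[of "p - q"]
    by (intro mult_left_mono order_trans[OF abs_triangle_ineq] add_mono)
       (auto simp: abs_mult dist_norm intro!: mult_right_mono)
  finally have T_diff: "\<bar>T p - T q\<bar> \<le> \<bar>a\<bar> * (1 + \<bar>u\<bar>) * dist p q" by (simp add: algebra_simps)
  have "\<bar>probit_loss a b p z - probit_loss a b q z\<bar> \<le> exp 2 * (1 + \<bar>T p\<bar> + \<bar>T q\<bar>) * \<bar>T p - T q\<bar>"
    using neg_log_Phi_diff_le[of "T p" "T q"] neg_log_Phi_diff_le[of "- T p" "- T q"]
    unfolding loss by (cases "snd z") (simp_all add: abs_minus_commute)
  also have "\<dots> \<le> exp 2 * ((1 + 2 * m) * (1 + \<bar>u\<bar>)) * (\<bar>a\<bar> * (1 + \<bar>u\<bar>) * dist p q)"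
    using T_le m by (intro mult_mono T_diff) (auto simp: algebra_simps)
  finally show ?thesis by (simp add: m_def u_def power2_eq_square mult_ac)
qed

text \<open>The loss is compared with \<open>neg_log_Phi 0\<close>; both the distance of the
  argument from 0 and the local Lipschitz constant grow linearly in \<open>fst z\<close>, hence the
  square.\<close>

lemma probit_loss_growth:
  "\<exists>C. \<forall>z. \<bar>probit_loss a b p z\<bar> \<le> C * (1 + \<bar>fst z\<bar>)\<^sup>2"
proof -
  define m where "m = \<bar>a\<bar> * norm p + \<bar>b\<bar>"
  have "\<bar>probit_loss a b p z\<bar> \<le> (neg_log_Phi 0 + exp 2 * ((1 + m) * m)) * (1 + \<bar>fst z\<bar>)\<^sup>2" for z
  proof -
    define u t where "u = fst z" and "t = a * (fst p * u + snd p) + b"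
    have t: "\<bar>t\<bar> \<le> m * (1 + \<bar>u\<bar>)"
      unfolding t_def m_def by (intro abs_probit_arg_le abs_fst_le_norm abs_snd_le_norm)
    have m: "0 \<le> m" by (simp add: m_def)
    have "\<bar>probit_loss a b p z\<bar> \<le> neg_log_Phi 0 + exp 2 * (1 + \<bar>t\<bar>) * \<bar>t\<bar>"
      using neg_log_Phi_diff_le[of t 0] neg_log_Phi_diff_le[of "- t" 0]
      by (cases "snd z") (simp_all add: probit_loss_def Let_def t_def[symmetric] u_def[symmetric]
            neg_log_Phi_nonneg abs_le_iff)
    also have "\<dots> \<le> neg_log_Phi 0 * (1 + \<bar>u\<bar>)\<^sup>2
        + exp 2 * ((1 + m) * (1 + \<bar>u\<bar>)) * (m * (1 + \<bar>u\<bar>))"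
    proof (rule add_mono)
      show "neg_log_Phi 0 \<le> neg_log_Phi 0 * (1 + \<bar>u\<bar>)\<^sup>2"
        using mult_left_mono[of 1 "(1 + \<bar>u\<bar>)\<^sup>2" "neg_log_Phi 0"] one_le_power[of "1 + \<bar>u\<bar>" 2]
        by (simp add: neg_log_Phi_nonneg)
      show "exp 2 * (1 + \<bar>t\<bar>) * \<bar>t\<bar> \<le> exp 2 * ((1 + m) * (1 + \<bar>u\<bar>)) * (m * (1 + \<bar>u\<bar>))"
        using t m by (intro mult_mono) (auto simp: algebra_simps)
    qed
    also have "neg_log_Phi 0 * r\<^sup>2 + exp 2 * ((1 + m) * r) * (m * r)
        = (neg_log_Phi 0 + exp 2 * ((1 + m) * m)) * r\<^sup>2" for r
      by (simp add: power2_eq_square algebra_simps)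
    finally show ?thesis by (simp only: u_def)
  qed
  thus ?thesis by blast
qed

section \<open>Identifiability of the parameters\<close>

lemma AE_normal_law_neq:
  assumes "s \<noteq> 0"
  shows "AE u in normal_law 0 s. u \<noteq> u0"
proof -
  have "AE u in lborel. 0 < ennreal (normal_density 0 s u) \<longrightarrow> u \<noteq> u0"
    using AE_lborel_singleton[of u0] by eventually_elim simp
  hence "AE u in density lborel (normal_density 0 s). u \<noteq> u0"
    by (subst AE_density) auto
  thus ?thesis unfolding normal_law_def using assms by simp
qed

text \<open>The difference of the risks is the integral of a gap that Gibbs' inequality makes
  nonnegative pointwise. Were it not positive, the two affine functions would agree almost
  everywhere; but distinct ones agree in at most one point, a null set for a nondegenerate normal
  law.\<close>

lemma probit_risk_less:
  assumes "s \<noteq> 0" "a \<noteq> 0" and neq: "p \<noteq> p0"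
    and f: "\<And>u. f u = Phi (a * (fst p0 * u + snd p0) + b)"
  defines "risk \<equiv> \<lambda>p. \<integral>u. f u * probit_loss a b p (u, True)
      + (1 - f u) * probit_loss a b p (u, False) \<partial>normal_law 0 s"
  shows "risk p0 < risk p"
proof (rule ccontr)
  interpret N: real_distribution "normal_law 0 s" by (rule real_distribution_normal_law)
  define I where "I = (\<lambda>p u. f u * probit_loss a b p (u, True) + (1 - f u) * probit_loss a b p (u, False))"
  define T where "T = (\<lambda>p u. a * (fst p * u + snd p) + b)"
  have [measurable]: "f \<in> borel_measurable borel" unfolding f[abs_def] by measurable
  have [measurable]: "I p \<in> borel_measurable borel" for p unfolding I_def by measurable
  have f01: "0 < f u" "f u < 1" for u by (simp_all add: f)
  have int_I: "integrable (normal_law 0 s) (I p)" for p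
  proof -
    obtain C where C: "\<And>z. \<bar>probit_loss a b p z\<bar> \<le> C * (1 + \<bar>fst z\<bar>)\<^sup>2"
      using probit_loss_growth by blast
    show ?thesis
    proof (rule integrable_normal_law_poly_bound[where C = C and k = 2])
      fix u
      have "\<bar>I p u\<bar> \<le> f u * \<bar>probit_loss a b p (u, True)\<bar> + (1 - f u) * \<bar>probit_loss a b p (u, False)\<bar>"
        unfolding I_def using f01[of u] by (intro order_trans[OF abs_triangle_ineq]) (simp add: abs_mult)
      also have "\<dots> \<le> f u * (C * (1 + \<bar>u\<bar>)\<^sup>2) + (1 - f u) * (C * (1 + \<bar>u\<bar>)\<^sup>2)"
        using f01[of u] C[of "(u, True)"] C[of "(u, False)"] by (intro add_mono mult_left_mono) auto
      finally show "\<bar>I p u\<bar> \<le> C * (1 + \<bar>u\<bar>)\<^sup>2" by (simp add: algebra_simps)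
    qed measurable
  qed
  have I_eq: "I p u = f u * - ln (Phi (T p u)) + (1 - f u) * - ln (1 - Phi (T p u))" for p u
    unfolding I_def probit_loss_simps neg_log_Phi_def T_def Phi_minus ..
  have I_less: "I p0 u < I p u" if "T p u \<noteq> T p0 u" for u
    using binary_cross_entropy_gt[of "f u" "Phi (T p u)"] that f01[of u] Phi_inj[of "T p u" "T p0 u"]
    unfolding I_eq by (auto simp: f T_def)
  have gap_nonneg: "0 \<le> I p u - I p0 u" for u
    using I_less[of u] by (cases "T p u = T p0 u") (simp_all add: I_eq)
  have gap_0: "T p u = T p0 u" if "I p u - I p0 u = 0" for u
    using I_less[of u] that by fastforce
  assume "\<not> risk p0 < risk p"
  hence "(\<integral>u. I p u - I p0 u \<partial>normal_law 0 s) \<le> 0"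
    using int_I by (simp add: risk_def I_def)
  moreover have "0 \<le> (\<integral>u. I p u - I p0 u \<partial>normal_law 0 s)"
    using gap_nonneg by (intro integral_nonneg_AE) auto
  ultimately have "(\<integral>u. I p u - I p0 u \<partial>normal_law 0 s) = 0" by linarith
  moreover have "integrable (normal_law 0 s) (\<lambda>u. I p u - I p0 u)" using int_I by simp
  ultimately have "AE u in normal_law 0 s. I p u - I p0 u = 0"
    using integral_nonneg_eq_0_iff_AE[of "normal_law 0 s" "\<lambda>u. I p u - I p0 u"] gap_nonneg by auto
  \<comment> \<open>The only possible crossing of the two lines. For equal slopes the quotient is 0
    by convention, which does no harm: the lines then differ in the intercept and never
    meet.\<close>
  moreover have "AE u in normal_law 0 s. u \<noteq> (snd p0 - snd p) / (fst p - fst p0)"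
    using \<open>s \<noteq> 0\<close> by (rule AE_normal_law_neq)
  ultimately have "AE u in normal_law 0 s. False"
  proof eventually_elim
    case (elim u)
    from gap_0[OF elim(1)] have "fst p * u + snd p = fst p0 * u + snd p0"
      using \<open>a \<noteq> 0\<close> by (simp add: T_def)
    hence "(fst p - fst p0) * u = snd p0 - snd p" by (simp add: algebra_simps)
    thus False
      using elim(2) neq by (cases "fst p = fst p0") (auto simp: field_simps prod_eq_iff)
  qed
  thus False by simp
qed

text \<open>The mean and the second moment depend only on \<open>f\<close>, \<open>s\<close> and
  \<open>G\<close>, hence not on the index, and the quadratic growth of \<open>G\<close> makes both
  finite.\<close>

lemma (in prob_space) data_model_weak_law:
  fixes v w :: "real^'d" and G :: "real \<times> bool \<Rightarrow> real"
  assumes S: "cov_matrix S" and model: "\<And>i :: nat. data_model M S \<sigma> w (x i) (y i)"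
    and ind: "indep_vars (\<lambda>_. borel \<Otimes>\<^sub>M count_space UNIV) (\<lambda>i \<omega>. (x i \<omega>, y i \<omega>)) UNIV"
    and \<sigma>: "\<And>t. \<sigma> t = Phi (a * t + b)"
    and w: "cov_norm S w = 1" and s: "s = cov_norm S v" "s \<noteq> 0"
    and c: "c = cov_inner S w v / s"
    and f: "\<And>u. f u = Phi ((a * (c * (u / s)) + b) / sqrt (1 + a\<^sup>2 * (1 - c\<^sup>2)))"
    and G_meas [measurable]: "\<And>l. (\<lambda>u. G (u, l)) \<in> borel_measurable borel"
    and growth: "\<And>z. \<bar>G z\<bar> \<le> C * (1 + \<bar>fst z\<bar>)\<^sup>2"
    and "0 < \<epsilon>"
  shows "(\<lambda>n. prob {\<omega> \<in> space M. \<epsilon> \<le> \<bar>(\<Sum>i<n. G (v \<bullet> x i \<omega>, y i \<omega>)) / n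
      - (\<integral>u. f u * G (u, True) + (1 - f u) * G (u, False) \<partial>normal_law 0 s)\<bar>}) \<longlonglongrightarrow> 0"
proof -
  have int1: "integrable (normal_law 0 s) (\<lambda>u. G (u, l))" for l
    by (rule integrable_normal_law_poly_bound[where C = C and k = 2]) (use growth[of "(_, l)"] in auto)
  have int2: "integrable (normal_law 0 s) (\<lambda>u. (G (u, l))\<^sup>2)" for l
  proof (rule integrable_normal_law_poly_bound[where C = "C\<^sup>2" and k = 4])
    fix u
    have "\<bar>G (u, l)\<bar>\<^sup>2 \<le> (C * (1 + \<bar>u\<bar>)\<^sup>2)\<^sup>2"
      using growth[of "(u, l)"] by (intro power_mono) auto
    thus "\<bar>(G (u, l))\<^sup>2\<bar> \<le> C\<^sup>2 * (1 + \<bar>u\<bar>) ^ 4"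
      by (simp add: power_mult_distrib)
  qed measurable
  \<comment> \<open>The label is discrete: splitting on its value reduces joint measurability to
    that of \<open>G\<close> at each label.\<close>
  have "(\<lambda>p. if snd p then G (v \<bullet> fst p, True) else G (v \<bullet> fst p, False))
      \<in> borel_measurable (borel \<Otimes>\<^sub>M count_space UNIV)"
    by measurable
  also have "(\<lambda>p. if snd p then G (v \<bullet> fst p, True) else G (v \<bullet> fst p, False))
      = (\<lambda>p. G (v \<bullet> fst p, snd p))"
    by (auto simp: fun_eq_iff)
  finally have meas: "(\<lambda>p. G (v \<bullet> fst p, snd p)) \<in> borel_measurable (borel \<Otimes>\<^sub>M count_space UNIV)" .
  have "indep_vars (\<lambda>_. borel) (\<lambda>i \<omega>. G (v \<bullet> x i \<omega>, y i \<omega>)) UNIV"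
    using indep_vars_compose2[OF ind, of "\<lambda>_ p. G (v \<bullet> fst p, snd p)" "\<lambda>_. borel"] meas by simp
  thus ?thesis
  proof (rule weak_law_of_large_numbers)
    fix i
    show "expectation (\<lambda>\<omega>. G (v \<bullet> x i \<omega>, y i \<omega>))
        = (\<integral>u. f u * G (u, True) + (1 - f u) * G (u, False) \<partial>normal_law 0 s)"
      using data_model_expectation(2)[OF S model \<sigma> w s c f, of "\<lambda>u l. G (u, l)" i] int1 by simp
    show "integrable M (\<lambda>\<omega>. (G (v \<bullet> x i \<omega>, y i \<omega>))\<^sup>2)"
      using data_model_expectation(1)[OF S model \<sigma> w s c f, of "\<lambda>u l. (G (u, l))\<^sup>2" i] int2 by simp
    show "expectation (\<lambda>\<omega>. (G (v \<bullet> x i \<omega>, y i \<omega>))\<^sup>2)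
        \<le> (\<integral>u. f u * (G (u, True))\<^sup>2 + (1 - f u) * (G (u, False))\<^sup>2 \<partial>normal_law 0 s)"
      using data_model_expectation(2)[OF S model \<sigma> w s c f, of "\<lambda>u l. (G (u, l))\<^sup>2" i] int2 by simp
  qed fact
qed

text \<open>A supremum over uncountably many \<open>u\<close> need not be measurable; continuity
  reduces it to a countable dense set.\<close>

lemma cSup_real_eq_cSup_Rats:
  fixes g :: "real \<Rightarrow> real"
  assumes cont: "continuous_on UNIV g" and bdd: "bdd_above (range g)"
  shows "(\<Squnion>u. g u) = (\<Squnion>u\<in>\<rat>. g u)"
proof (rule antisym)
  have bdd': "bdd_above (g ` \<rat>)" using bdd by (rule bdd_above_mono) auto
  show "(\<Squnion>u. g u) \<le> (\<Squnion>u\<in>\<rat>. g u)"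
  proof (rule cSUP_least)
    fix u
    show "g u \<le> (\<Squnion>u\<in>\<rat>. g u)"
      by (rule continuous_le_on_closure[of \<rat>])
         (auto simp: Rats_closure_real intro: continuous_on_subset[OF cont] cSUP_upper[OF _ bdd'])
  qed simp
  show "(\<Squnion>u\<in>\<rat>. g u) \<le> (\<Squnion>u. g u)"
    by (rule cSUP_subset_mono) (use bdd in \<open>auto intro: exI[of _ 0]\<close>)
qed

text \<open>A deterministic modulus of continuity, uniform in \<open>n\<close> and
  \<open>\<omega>\<close>, carries convergence of \<open>D\<close> over to \<open>X\<close>. In the
  application \<open>D\<close> is the distance of the estimated parameters from the true
  ones.\<close>

lemma (in prob_space) tendsto_in_probI:
  fixes X D :: "nat \<Rightarrow> 'a \<Rightarrow> real"
  assumes [measurable]: "\<And>n. X n \<in> borel_measurable M" "\<And>n. D n \<in> borel_measurable M"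
    and lim: "\<And>\<delta>. 0 < \<delta> \<Longrightarrow> (\<lambda>n. prob {\<omega> \<in> space M. \<delta> \<le> D n \<omega>}) \<longlonglongrightarrow> 0"
    and cont: "\<And>\<epsilon>. 0 < \<epsilon> \<Longrightarrow> \<exists>\<delta>>0. \<forall>n. \<forall>\<omega>\<in>space M. D n \<omega> < \<delta> \<longrightarrow> \<bar>X n \<omega> - c\<bar> \<le> \<epsilon>"
  shows "tendsto_in_prob M X c"
  unfolding tendsto_in_prob_def
proof (intro conjI allI impI)
  fix \<epsilon> :: real assume "0 < \<epsilon>"
  then obtain \<delta> where \<delta>: "0 < \<delta>" "\<And>n \<omega>. \<omega> \<in> space M \<Longrightarrow> D n \<omega> < \<delta> \<Longrightarrow> \<bar>X n \<omega> - c\<bar> \<le> \<epsilon>"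
    using cont by blast
  have "prob {\<omega> \<in> space M. \<bar>X n \<omega> - c\<bar> > \<epsilon>} \<le> prob {\<omega> \<in> space M. \<delta> \<le> D n \<omega>}" for n
  proof (rule finite_measure_mono)
    show "{\<omega> \<in> space M. \<bar>X n \<omega> - c\<bar> > \<epsilon>} \<subseteq> {\<omega> \<in> space M. \<delta> \<le> D n \<omega>}"
    proof (clarify, rule ccontr)
      fix \<omega> assume "\<omega> \<in> space M" "\<bar>X n \<omega> - c\<bar> > \<epsilon>" "\<not> \<delta> \<le> D n \<omega>"
      thus False using \<delta>(2)[of \<omega> n] by (simp add: not_le)
    qed
  qed measurable
  thus "(\<lambda>n. prob {\<omega> \<in> space M. \<bar>X n \<omega> - c\<bar> > \<epsilon>}) \<longlonglongrightarrow> 0"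
    by (intro tendsto_sandwich[OF _ _ tendsto_const lim[OF \<delta>(1)]] always_eventually allI) auto
qed simp

section \<open>Platt scaling\<close>

text \<open>In the variable \<open>v = \<alpha> * u + \<beta>\<close> the first argument is
  \<open>r * v + c\<close> with \<open>r = \<alpha>' / \<alpha>\<close>, and
  \<open>Phi_affine_perturbation\<close> bounds the difference independently of \<open>v\<close>.
  This is where the slope of the limit must not vanish.\<close>

lemma Phi_affine_sup_le:
  assumes "\<alpha> \<noteq> 0" "1 / 2 \<le> \<alpha>' / \<alpha>"
  shows "(\<Squnion>u. \<bar>Phi (\<alpha>' * u + \<beta>') - Phi (\<alpha> * u + \<beta>)\<bar>)
    \<le> \<bar>\<beta>' - \<alpha>' / \<alpha> * \<beta>\<bar> + 2 * \<bar>\<alpha>' / \<alpha> - 1\<bar>"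
proof (rule cSUP_least)
  fix u
  have "\<alpha>' * u + \<beta>' = \<alpha>' / \<alpha> * (\<alpha> * u + \<beta>) + (\<beta>' - \<alpha>' / \<alpha> * \<beta>)"
    using assms(1) by (simp add: field_simps)
  thus "\<bar>Phi (\<alpha>' * u + \<beta>') - Phi (\<alpha> * u + \<beta>)\<bar>
      \<le> \<bar>\<beta>' - \<alpha>' / \<alpha> * \<beta>\<bar> + 2 * \<bar>\<alpha>' / \<alpha> - 1\<bar>"
    using Phi_affine_perturbation[OF assms(2), of "\<alpha> * u + \<beta>" "\<beta>' - \<alpha>' / \<alpha> * \<beta>"]
    by (simp only:)
qed simp

lemma abs_Phi_diff_le_1: "\<bar>Phi x - Phi y\<bar> \<le> 1"
  using Phi_pos[of x] Phi_less_1[of x] Phi_pos[of y] Phi_less_1[of y] by linarith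

lemma bdd_above_abs_Phi_diff: "bdd_above ((\<lambda>u. \<bar>Phi (f u) - Phi (g u)\<bar>) ` A)"
  by (rule bdd_aboveI2[of _ _ 1]) (rule abs_Phi_diff_le_1)

lemma Phi_affine_sup_nonneg: "0 \<le> (\<Squnion>u. \<bar>Phi (f u) - Phi (g u)\<bar>)"
  by (rule cSUP_upper2[OF bdd_above_abs_Phi_diff UNIV_I[of undefined]]) simp

lemma Phi_affine_sup_measurable:
  assumes [measurable]: "\<alpha>' \<in> borel_measurable M" "\<beta>' \<in> borel_measurable M"
  shows "(\<lambda>\<omega>. \<Squnion>u. \<bar>Phi (\<alpha>' \<omega> * u + \<beta>' \<omega>) - Phi (\<alpha> * u + \<beta>)\<bar>) \<in> borel_measurable M"
proof -
  have "(\<lambda>\<omega>. \<Squnion>u\<in>\<rat>. \<bar>Phi (\<alpha>' \<omega> * u + \<beta>' \<omega>) - Phi (\<alpha> * u + \<beta>)\<bar>) \<in> borel_measurable M"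
    by (intro borel_measurable_cSUP countable_rat bdd_above_abs_Phi_diff) measurable
  moreover have "(\<Squnion>u. \<bar>Phi (x * u + y) - Phi (\<alpha> * u + \<beta>)\<bar>)
      = (\<Squnion>u\<in>\<rat>. \<bar>Phi (x * u + y) - Phi (\<alpha> * u + \<beta>)\<bar>)" for x y
    by (intro cSup_real_eq_cSup_Rats continuous_intros bdd_above_abs_Phi_diff)
  ultimately show ?thesis by simp
qed

lemma (in prob_space) probit_mle_consistent:
  fixes v w :: "real^'d" and est :: "nat \<Rightarrow> 'a \<Rightarrow> real \<times> real"
  assumes S: "cov_matrix S" and model: "\<And>i :: nat. data_model M S \<sigma> w (x i) (y i)"
    and ind: "indep_vars (\<lambda>_. borel \<Otimes>\<^sub>M count_space UNIV) (\<lambda>i \<omega>. (x i \<omega>, y i \<omega>)) UNIV"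
    and \<sigma>: "\<And>t. \<sigma> t = Phi (a * t + b)" and "a \<noteq> 0"
    and w: "cov_norm S w = 1" and s: "s = cov_norm S v" "s \<noteq> 0"
    and c: "c = cov_inner S w v / s"
    and p0: "\<And>u. (a * (c * (u / s)) + b) / sqrt (1 + a\<^sup>2 * (1 - c\<^sup>2)) = a * (fst p0 * u + snd p0) + b"
    and H: "compact H" "p0 \<in> H"
    and est: "\<And>n \<omega>. \<omega> \<in> space M \<Longrightarrow>
      is_arg_min (\<lambda>p. \<Sum>i<n. probit_loss a b p (v \<bullet> x i \<omega>, y i \<omega>)) (\<lambda>p. p \<in> H) (est n \<omega>)"
    and "0 < \<epsilon>"
  shows "(\<lambda>n. prob {\<omega> \<in> space M. \<epsilon> \<le> dist (est n \<omega>) p0}) \<longlonglongrightarrow> 0"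
proof -
  have [measurable]: "x i \<in> borel_measurable M" "y i \<in> measurable M (count_space UNIV)" for i
    using model[of i] by (auto simp: data_model_def centered_gaussian_def)
  have Z_meas: "(\<lambda>\<omega>. G (v \<bullet> x i \<omega>, y i \<omega>)) \<in> borel_measurable M"
    if [measurable]: "\<And>l. (\<lambda>u. G (u, l)) \<in> borel_measurable borel" for G :: "real \<times> bool \<Rightarrow> real" and i
  proof -
    have "(\<lambda>\<omega>. if y i \<omega> then G (v \<bullet> x i \<omega>, True) else G (v \<bullet> x i \<omega>, False)) \<in> borel_measurable M"
      by measurable
    also have "(\<lambda>\<omega>. if y i \<omega> then G (v \<bullet> x i \<omega>, True) else G (v \<bullet> x i \<omega>, False))
        = (\<lambda>\<omega>. G (v \<bullet> x i \<omega>, y i \<omega>))"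
      by (auto simp: fun_eq_iff)
    finally show ?thesis .
  qed
  define f where "f = (\<lambda>u. Phi ((a * (c * (u / s)) + b) / sqrt (1 + a\<^sup>2 * (1 - c\<^sup>2))))"
  define E where "E = (\<lambda>G. \<integral>u. f u * G (u, True) + (1 - f u) * G (u, False) \<partial>normal_law 0 s)"
  obtain R where R: "\<And>p. p \<in> H \<Longrightarrow> norm p \<le> R"
    using compact_imp_bounded[OF H(1)] by (auto simp: bounded_iff)
  \<comment> \<open>The Lipschitz constant on a ball containing \<open>H\<close>. Multiplied by the
    quadratic in \<open>fst z\<close> it gives \<open>K\<close>, which satisfies the same growth
    condition as the losses, so one law of large numbers covers both.\<close>
  define C where "C = exp 2 * (1 + 2 * (\<bar>a\<bar> * R + \<bar>b\<bar>)) * \<bar>a\<bar>"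
  have "0 \<le> R" using R[OF H(2)] norm_ge_zero order_trans by blast
  hence "0 \<le> C" by (simp add: C_def)
  define K where "K = (\<lambda>z :: real \<times> bool. C * (1 + \<bar>fst z\<bar>)\<^sup>2)"
  have wlln: "(\<lambda>n. prob {\<omega> \<in> space M. \<epsilon> \<le> \<bar>(\<Sum>i<n. G (v \<bullet> x i \<omega>, y i \<omega>)) / n - E G\<bar>}) \<longlonglongrightarrow> 0"
    if "\<And>l. (\<lambda>u. G (u, l)) \<in> borel_measurable borel" "\<And>z. \<bar>G z\<bar> \<le> B * (1 + \<bar>fst z\<bar>)\<^sup>2" "0 < \<epsilon>"
    for G B \<epsilon>
    unfolding E_def
    by (rule data_model_weak_law[OF S model ind \<sigma> w s c _ that]) (simp add: f_def)
  show ?thesis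
  proof (rule M_estimator_consistent[OF H, where L = "probit_loss a b" and K = K and k = "E K"
        and Z = "\<lambda>i \<omega>. (v \<bullet> x i \<omega>, y i \<omega>)" and risk = "\<lambda>p. E (probit_loss a b p)"])
    show "\<bar>probit_loss a b p z - probit_loss a b q z\<bar> \<le> K z * dist p q"
      if "p \<in> H" "q \<in> H" for p q z
      unfolding K_def C_def using probit_loss_Lipschitz[OF R[OF that(1)] R[OF that(2)]] .
    show "(\<lambda>\<omega>. probit_loss a b p (v \<bullet> x i \<omega>, y i \<omega>)) \<in> borel_measurable M" for p i
      by (rule Z_meas) measurable
    show "(\<lambda>\<omega>. K (v \<bullet> x i \<omega>, y i \<omega>)) \<in> borel_measurable M" for i
      by (rule Z_meas) (simp add: K_def)
    fix \<epsilon> :: real assume "0 < \<epsilon>"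
    show "(\<lambda>n. prob {\<omega> \<in> space M. \<epsilon> \<le> \<bar>(\<Sum>i<n. K (v \<bullet> x i \<omega>, y i \<omega>)) / n - E K\<bar>}) \<longlonglongrightarrow> 0"
      by (rule wlln[of K C]) (use \<open>0 \<le> C\<close> \<open>0 < \<epsilon>\<close> in \<open>auto simp: K_def\<close>)
    fix p assume "p \<in> H"
    obtain C' where "\<And>z. \<bar>probit_loss a b p z\<bar> \<le> C' * (1 + \<bar>fst z\<bar>)\<^sup>2"
      using probit_loss_growth by blast
    thus "(\<lambda>n. prob {\<omega> \<in> space M. \<epsilon> \<le> \<bar>(\<Sum>i<n. probit_loss a b p (v \<bullet> x i \<omega>, y i \<omega>)) / n
        - E (probit_loss a b p)\<bar>}) \<longlonglongrightarrow> 0"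
      using \<open>0 < \<epsilon>\<close> by (intro wlln) auto
  next
    show "E (probit_loss a b p0) < E (probit_loss a b p)" if "p \<noteq> p0" for p
      unfolding E_def using s(2) \<open>a \<noteq> 0\<close> that by (rule probit_risk_less) (simp only: f_def p0)
    show "est n \<omega> \<in> H"
      "(\<Sum>i<n. probit_loss a b (est n \<omega>) (v \<bullet> x i \<omega>, y i \<omega>))
        \<le> (\<Sum>i<n. probit_loss a b p0 (v \<bullet> x i \<omega>, y i \<omega>))" if "\<omega> \<in> space M" for n \<omega>
      using est[OF that, of n] H(2) unfolding is_arg_min_linorder by blast+
  qed fact
qed

lemma holdout_nll_eq_probit_loss:
  assumes "\<And>t. \<sigma> t = Phi (a * t + b)"
  shows "holdout_nll v n x y (\<lambda>u. \<sigma> (A * u + B)) = (\<Sum>i<n. probit_loss a b (A, B) (v \<bullet> x i, y i))"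
  unfolding holdout_nll_def assms Phi_minus[symmetric]
  by (intro sum.cong refl) (simp add: probit_loss_def neg_log_Phi_def Let_def)

text \<open>\<open>cos\<close> inverts \<open>arccos\<close> only on [-1, 1]. The Cauchy-Schwarz
  bound that this requires follows from the nonnegative variance \<open>1 - c\<^sup>2\<close> of the
  residual of \<open>u\<close> after projection onto \<open>v\<close>.\<close>

lemma cos_cov_angle:
  assumes S: "cov_matrix S" and "cov_norm S u = 1" "cov_norm S v \<noteq> 0"
  shows "cos (cov_angle S u v) = cov_inner S u v / cov_norm S v"
proof -
  define c s where "c = cov_inner S u v / cov_norm S v" and "s = cov_norm S v"
  have "0 \<le> (cov_norm S (1 *\<^sub>R u + (- (c / s)) *\<^sub>R v))\<^sup>2" by simp
  also have "\<dots> = 1 - c\<^sup>2"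
    unfolding cov_norm_square_combine[OF S] assms(2) s_def[symmetric]
    using assms(3) by (simp add: c_def s_def power2_eq_square field_simps)
  finally have "\<bar>c\<bar> \<le> 1" by (simp add: abs_square_le_1)
  thus ?thesis
    using assms by (simp add: cov_angle_def c_def cos_arccos_abs)
qed

theorem theorem5p1:
  fixes S :: "real^'d^'d"
    and w_star w_hat :: "real^'d"
    and \<sigma> :: "real \<Rightarrow> real"
    and a b \<theta> A_star B_star :: real
    and n :: nat
    and x_tr :: "nat \<Rightarrow> real^'d"
    and y_tr :: "nat \<Rightarrow> bool"
    and loss :: "bool \<Rightarrow> real \<Rightarrow> real"
    and g :: "real^'d \<Rightarrow> real"
    and H :: "(real \<times> real) set"
    and M :: "'w measure"
    and x_ho :: "nat \<Rightarrow> 'w \<Rightarrow> real^'d"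
    and y_ho :: "nat \<Rightarrow> 'w \<Rightarrow> bool"
    and A_hat B_hat :: "nat \<Rightarrow> 'w \<Rightarrow> real"
  assumes "cov_matrix S"
    and "cov_norm S w_star = 1"
    and "n > 0"
    and "\<And>y. convex_on UNIV (loss y)"
    and "convex_on UNIV g"
    and "is_arg_min (empirical_risk n x_tr y_tr loss g) (\<lambda>w. True) w_hat"
    and "cov_norm S w_hat \<noteq> 0"
    and "a \<noteq> 0"
    and "\<And>t. \<sigma> t = cdf std_normal_distribution (a * t + b)"
    and "\<theta> = cov_angle S w_star w_hat"
    and "A_star = cos \<theta> / (cov_norm S w_hat * sqrt (1 + a\<^sup>2 * (sin \<theta>)\<^sup>2))"
    and "B_star = b / a * (1 / sqrt (1 + a\<^sup>2 * (sin \<theta>)\<^sup>2) - 1)"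
    and "compact H" and "(A_star, B_star) \<in> H"
    and "prob_space M"
    and "\<And>i. data_model M S \<sigma> w_star (x_ho i) (y_ho i)"
    and "prob_space.indep_vars M (\<lambda>_. borel \<Otimes>\<^sub>M count_space UNIV)
           (\<lambda>i \<omega>. (x_ho i \<omega>, y_ho i \<omega>)) UNIV"
    and "\<And>m. A_hat m \<in> borel_measurable M" and "\<And>m. B_hat m \<in> borel_measurable M"
    and "\<And>m \<omega>. \<omega> \<in> space M \<Longrightarrow>
           is_arg_min (\<lambda>(A, B). holdout_nll w_hat m (\<lambda>i. x_ho i \<omega>) (\<lambda>i. y_ho i \<omega>)
                                  (\<lambda>u. \<sigma> (A * u + B)))
             (\<lambda>p. p \<in> H) (A_hat m \<omega>, B_hat m \<omega>)"
  shows "(\<forall>u. angular_predictor S \<sigma> w_hat u \<theta> = \<sigma> (A_star * u + B_star))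
    \<and> (\<lambda>u. angular_predictor S \<sigma> w_hat u \<theta>) \<in> platt_class \<sigma>
    \<and> tendsto_in_prob M A_hat A_star
    \<and> tendsto_in_prob M B_hat B_star
    \<and> (cos \<theta> \<noteq> 0 \<longrightarrow>
        tendsto_in_prob M
          (\<lambda>m \<omega>. \<Squnion>u. \<bar>\<sigma> (A_hat m \<omega> * u + B_hat m \<omega>)
                         - angular_predictor S \<sigma> w_hat u \<theta>\<bar>) 0)"
proof -
  note S = assms(1) and \<sigma> = assms(9)
  interpret prob_space M by fact
  have [measurable]: "A_hat m \<in> borel_measurable M" "B_hat m \<in> borel_measurable M" for m
    by fact+
  define s where "s = cov_norm S w_hat"
  define c where "c = cov_inner S w_star w_hat / s"
  define \<kappa> where "\<kappa> = sqrt (1 + a\<^sup>2 * (sin \<theta>)\<^sup>2)"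
  have s: "s \<noteq> 0" using assms(7) by (simp add: s_def)
  have cos_\<theta>: "cos \<theta> = c"
    unfolding assms(10) c_def s_def by (rule cos_cov_angle[OF S assms(2,7)])
  have "0 < 1 + a\<^sup>2 * (sin \<theta>)\<^sup>2" by (intro add_pos_nonneg) auto
  hence \<kappa>: "\<kappa> \<noteq> 0" "0 < \<kappa>" by (simp_all add: \<kappa>_def)
  have \<kappa>_c: "sqrt (1 + a\<^sup>2 * (1 - c\<^sup>2)) = \<kappa>"
    unfolding \<kappa>_def sin_squared_eq cos_\<theta> ..
  \<comment> \<open>Comparing slope and intercept in \<open>u\<close> and solving for the two
    parameters is the origin of the formulas for \<open>A_star\<close> and
    \<open>B_star\<close>.\<close>
  have arg: "(a * (c * (u / s)) + b) / \<kappa> = a * (A_star * u + B_star) + b" for u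
    unfolding assms(11,12) \<kappa>_def[symmetric] s_def[symmetric] cos_\<theta>
    using s \<kappa> \<open>a \<noteq> 0\<close> by (simp add: field_simps)
  have ang: "angular_predictor S \<sigma> w_hat u \<theta> = Phi (a * (A_star * u + B_star) + b)" for u
  proof -
    have "angular_predictor S \<sigma> w_hat u \<theta>
        = (\<integral>z. Phi ((a * (c * (u / s)) + b) + (a * sin \<theta>) * z) \<partial>std_normal_distribution)"
      unfolding angular_predictor_def \<sigma> cos_\<theta> s_def[symmetric] by (simp add: algebra_simps)
    thus ?thesis
      by (simp only: integral_Phi_affine power_mult_distrib \<kappa>_def[symmetric] arg)
  qed
  define D where "D = (\<lambda>m \<omega>. dist (A_hat m \<omega>, B_hat m \<omega>) (A_star, B_star))"
  have [measurable]: "D m \<in> borel_measurable M" for m unfolding D_def by measurable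
  have consistent: "(\<lambda>m. prob {\<omega> \<in> space M. \<delta> \<le> D m \<omega>}) \<longlonglongrightarrow> 0" if "0 < \<delta>" for \<delta>
    unfolding D_def
  proof (rule probit_mle_consistent[OF S assms(16) assms(17) \<sigma> \<open>a \<noteq> 0\<close> assms(2) s_def s c_def _
        assms(13,14) _ that])
    show "(a * (c * (u / s)) + b) / sqrt (1 + a\<^sup>2 * (1 - c\<^sup>2))
        = a * (fst (A_star, B_star) * u + snd (A_star, B_star)) + b" for u
      unfolding \<kappa>_c arg by simp
    show "is_arg_min (\<lambda>p. \<Sum>i<m. probit_loss a b p (w_hat \<bullet> x_ho i \<omega>, y_ho i \<omega>)) (\<lambda>p. p \<in> H)
        (A_hat m \<omega>, B_hat m \<omega>)" if "\<omega> \<in> space M" for m \<omega>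
    proof -
      have "(\<lambda>(A, B). holdout_nll w_hat m (\<lambda>i. x_ho i \<omega>) (\<lambda>i. y_ho i \<omega>) (\<lambda>u. \<sigma> (A * u + B)))
          = (\<lambda>p. \<Sum>i<m. probit_loss a b p (w_hat \<bullet> x_ho i \<omega>, y_ho i \<omega>))"
        unfolding holdout_nll_eq_probit_loss[OF \<sigma>] by auto
      thus ?thesis using assms(20)[OF that, of m] by (simp only:)
    qed
  qed
  have close: "\<bar>A_hat m \<omega> - A_star\<bar> \<le> D m \<omega>" "\<bar>B_hat m \<omega> - B_star\<bar> \<le> D m \<omega>" for m \<omega>
    using abs_fst_le_norm[of "(A_hat m \<omega>, B_hat m \<omega>) - (A_star, B_star)"]
      abs_snd_le_norm[of "(A_hat m \<omega>, B_hat m \<omega>) - (A_star, B_star)"]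
    by (simp_all add: D_def dist_norm)
  have A_lim: "tendsto_in_prob M A_hat A_star" and B_lim: "tendsto_in_prob M B_hat B_star"
  proof (rule_tac [!] tendsto_in_probI[of _ D])
    fix \<epsilon> :: real assume "0 < \<epsilon>"
    show "\<exists>\<delta>>0. \<forall>n. \<forall>\<omega>\<in>space M. D n \<omega> < \<delta> \<longrightarrow> \<bar>A_hat n \<omega> - A_star\<bar> \<le> \<epsilon>"
      "\<exists>\<delta>>0. \<forall>n. \<forall>\<omega>\<in>space M. D n \<omega> < \<delta> \<longrightarrow> \<bar>B_hat n \<omega> - B_star\<bar> \<le> \<epsilon>"
      using close \<open>0 < \<epsilon>\<close> by (meson less_eq_real_def order_trans)+
  qed (simp_all add: consistent)
  have sup_lim: "tendsto_in_prob M
      (\<lambda>m \<omega>. \<Squnion>u. \<bar>\<sigma> (A_hat m \<omega> * u + B_hat m \<omega>) - angular_predictor S \<sigma> w_hat u \<theta>\<bar>) 0"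
    if "cos \<theta> \<noteq> 0"
  proof -
    define \<alpha> \<beta> where "\<alpha> = a * A_star" and "\<beta> = a * B_star + b"
    have A0: "A_star \<noteq> 0"
      using that s \<kappa> unfolding assms(11) \<kappa>_def[symmetric] s_def[symmetric] by simp
    hence "\<alpha> \<noteq> 0" using \<open>a \<noteq> 0\<close> by (simp add: \<alpha>_def)
    have eq: "(\<Squnion>u. \<bar>\<sigma> (A * u + B) - angular_predictor S \<sigma> w_hat u \<theta>\<bar>)
        = (\<Squnion>u. \<bar>Phi ((a * A) * u + (a * B + b)) - Phi (\<alpha> * u + \<beta>)\<bar>)" for A B
      unfolding ang \<sigma> \<alpha>_def \<beta>_def by (simp add: algebra_simps)
    show ?thesis
      unfolding eq
    proof (rule tendsto_in_probI[of _ D])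
      show "(\<lambda>\<omega>. \<Squnion>u. \<bar>Phi ((a * A_hat m \<omega>) * u + (a * B_hat m \<omega> + b)) - Phi (\<alpha> * u + \<beta>)\<bar>)
          \<in> borel_measurable M" for m
        by (rule Phi_affine_sup_measurable) measurable
      fix \<epsilon> :: real assume "0 < \<epsilon>"
      \<comment> \<open>The three parts of \<open>C\<close> account for the error of
        \<open>B_hat\<close>, for \<open>\<beta>\<close> times the relative error of the slope, and
        for twice that relative error. In \<open>\<delta>\<close>, the first entry of the minimum
        keeps the slope ratio \<open>r\<close> at least 1/2, and the second makes the total at most
        \<open>\<epsilon>\<close>.\<close>
      define C where "C = \<bar>a\<bar> + (\<bar>\<beta>\<bar> + 2) / \<bar>A_star\<bar>"
      have "0 < C" using A0 by (auto simp: C_def intro!: add_nonneg_pos divide_pos_pos)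
      define \<delta> where "\<delta> = min (\<bar>A_star\<bar> / 2) (\<epsilon> / C)"
      have "\<bar>(\<Squnion>u. \<bar>Phi ((a * A_hat m \<omega>) * u + (a * B_hat m \<omega> + b)) - Phi (\<alpha> * u + \<beta>)\<bar>) - 0\<bar> \<le> \<epsilon>"
        if "D m \<omega> < \<delta>" for m \<omega>
      proof -
        define r where "r = A_hat m \<omega> / A_star"
        have r: "(a * A_hat m \<omega>) / \<alpha> = r" using \<open>a \<noteq> 0\<close> by (simp add: r_def \<alpha>_def)
        have "\<bar>r - 1\<bar> = \<bar>A_hat m \<omega> - A_star\<bar> / \<bar>A_star\<bar>"
          using A0 by (simp add: r_def diff_divide_distrib flip: abs_divide)
        also have "\<dots> \<le> \<delta> / \<bar>A_star\<bar>"
          using close(1)[of m \<omega>] that by (intro divide_right_mono) auto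
        finally have r1: "\<bar>r - 1\<bar> \<le> \<delta> / \<bar>A_star\<bar>" .
        also have "\<dots> \<le> 1 / 2" using A0 by (simp add: \<delta>_def field_simps)
        finally have r_half: "1 / 2 \<le> r" by linarith
        have "a * B_hat m \<omega> + b - r * \<beta> = a * (B_hat m \<omega> - B_star) - \<beta> * (r - 1)"
          by (simp add: \<beta>_def algebra_simps)
        hence "\<bar>a * B_hat m \<omega> + b - r * \<beta>\<bar> \<le> \<bar>a\<bar> * \<bar>B_hat m \<omega> - B_star\<bar> + \<bar>\<beta>\<bar> * \<bar>r - 1\<bar>"
          by (simp only: abs_mult[symmetric] abs_triangle_ineq4)
        also have "\<dots> \<le> \<bar>a\<bar> * \<delta> + \<bar>\<beta>\<bar> * (\<delta> / \<bar>A_star\<bar>)"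
          using close(2)[of m \<omega>] that r1 by (intro add_mono mult_left_mono) auto
        finally have "\<bar>a * B_hat m \<omega> + b - r * \<beta>\<bar> + 2 * \<bar>r - 1\<bar>
            \<le> \<bar>a\<bar> * \<delta> + \<bar>\<beta>\<bar> * (\<delta> / \<bar>A_star\<bar>) + 2 * (\<delta> / \<bar>A_star\<bar>)"
          using r1 by linarith
        also have "\<dots> = C * \<delta>" by (simp add: C_def algebra_simps add_divide_distrib)
        also have "\<dots> \<le> C * (\<epsilon> / C)"
          using \<open>0 < C\<close> by (intro mult_left_mono) (auto simp: \<delta>_def)
        also have "\<dots> = \<epsilon>" using \<open>0 < C\<close> by simp
        finally have "(\<Squnion>u. \<bar>Phi ((a * A_hat m \<omega>) * u + (a * B_hat m \<omega> + b)) - Phi (\<alpha> * u + \<beta>)\<bar>) \<le> \<epsilon>"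
          using Phi_affine_sup_le[OF \<open>\<alpha> \<noteq> 0\<close>, of "a * A_hat m \<omega>" "a * B_hat m \<omega> + b" \<beta>] r_half
          unfolding r by linarith
        thus ?thesis by (simp only: diff_0_right abs_of_nonneg[OF Phi_affine_sup_nonneg])
      qed
      moreover have "0 < \<delta>" using A0 \<open>0 < \<epsilon>\<close> \<open>0 < C\<close> by (simp add: \<delta>_def)
      ultimately show "\<exists>\<delta>>0. \<forall>n. \<forall>\<omega>\<in>space M. D n \<omega> < \<delta> \<longrightarrow>
          \<bar>(\<Squnion>u. \<bar>Phi ((a * A_hat n \<omega>) * u + (a * B_hat n \<omega> + b)) - Phi (\<alpha> * u + \<beta>)\<bar>) - 0\<bar> \<le> \<epsilon>"
        by blast
    qed (simp_all add: consistent)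
  qed
  show ?thesis
    using ang A_lim B_lim sup_lim by (auto simp: platt_class_def \<sigma>)
qed

end
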